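(* Let $G=(X,b,m)$ be a connected, locally finite weighted graph. Suppose there is a constant $K>0$ such that for every choice of base vertex $x_0\in X$ and every $x\in X$, the outer and inner curvatures $\kappa_\pm$ taken with respect to $x_0$ satisfy $$\kappa_+(x)-\kappa_-(x)\le K .$$ Then $G$ is Feller.
   Context: Weighted graph: $G=(X,b,m)$ where $X$ is a countably infinite set (vertices), $b:X\times X\to[0,\infty)$ satisfies $b(x,y)=b(y,x)$, $b(x,x)=0$ and $|\{y : b(x,y)>0\}|<\infty$ for all $x$ (local finiteness), and $m:X\to(0,\infty)$ is a vertex measure, extended to subsets of $X$ by additivity. Write $x\sim y$ if $b(x,y)>0$. $G$ is connected if any two vertices are joined by a finite path $x=x_0\sim x_1\sim\dots\sim x_n=y$; $d(x,y)$ is the least number $n$ of edges of such a path (combinatorial graph metric). Laplacian and heat semigroup: the formal Laplacian is $\widetilde\Delta f(x)=\frac1{m(x)}\sum_{y\in X}b(x,y)(f(x)-f(y))$ for $f:X\to\mathbb{R}$. $C_c(X)$ is the space of finitely supported real functions, and $\ell^2(X,m)$ is the Hilbert space of real functions with $\sum_x f(x)^2m(x)<\infty$, with inner product $\langle f,g\rangle=\sum_x f(x)g(x)m(x)$. $\Delta$ is the Friedrichs extension in $\ell^2(X,m)$ of $\widetilde\Delta|_{C_c(X)}$, i.e. the self-adjoint operator of the closure of the form $\frac12\sum_{x,y}b(x,y)(f(x)-f(y))(g(x)-g(y))$ on $C_c(X)$. The semigroup $P_t=e^{-t\Delta}$ has a heat kernel $p_t(x,y)\ge 0$ and acts on bounded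 functions by $P_tf(x)=\sum_{y\in X}p_t(x,y)f(y)m(y)$. Feller: $C_0(X)$ is the space of functions vanishing at infinity, i.e. the closure of $C_c(X)$ in the sup norm. $G$ is Feller if $P_t$ maps $C_0(X)$ into $C_0(X)$ for all $t\ge0$. Curvatures: for $x_0\in X$ and integer $r$ let $S_r(x_0)=\{y : d(y,x_0)=r\}$ (empty if $r<0$). For $x\in S_r(x_0)$, the outer ($+$) and inner ($-$) curvatures with respect to $x_0$ are $\kappa_\pm(x)=\frac1{m(x)}\sum_{y\in S_{r\pm1}(x_0)}b(x,y)$. *)

theory Defs
  imports "HOL-Analysis.Analysis"
begin

section \<open>Weighted graphs\<close>

text \<open>The countably infinite vertex set is the universe of the type \<open>'v\<close>.\<close>

locale weighted_graph =
  fixes b :: "'v \<Rightarrow> 'v \<Rightarrow> real" and m :: "'v \<Rightarrow> real"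
  assumes countable_vertices: "countable (UNIV :: 'v set)"
    and infinite_vertices: "infinite (UNIV :: 'v set)"
    and weight_nonneg: "b x y \<ge> 0"
    and weight_sym: "b x y = b y x"
    and weight_diag: "b x x = 0"
    and locally_finite: "finite {y. b x y > 0}"
    and measure_pos: "m x > 0"

definition adjacent :: "('v \<Rightarrow> 'v \<Rightarrow> real) \<Rightarrow> 'v \<Rightarrow> 'v \<Rightarrow> bool" where
  "adjacent b x y \<longleftrightarrow> b x y > 0"

definition connected_graph :: "('v \<Rightarrow> 'v \<Rightarrow> real) \<Rightarrow> bool" where
  "connected_graph b \<longleftrightarrow> (\<forall>x y. \<exists>n. (adjacent b ^^ n) x y)"

definition graph_dist :: "('v \<Rightarrow> 'v \<Rightarrow> real) \<Rightarrow> 'v \<Rightarrow> 'v \<Rightarrow> nat" where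
  "graph_dist b x y = (LEAST n. (adjacent b ^^ n) x y)"

definition graph_sphere :: "('v \<Rightarrow> 'v \<Rightarrow> real) \<Rightarrow> 'v \<Rightarrow> int \<Rightarrow> 'v set" where
  "graph_sphere b x0 r = {y. int (graph_dist b y x0) = r}"

definition outer_curvature ::
  "('v \<Rightarrow> 'v \<Rightarrow> real) \<Rightarrow> ('v \<Rightarrow> real) \<Rightarrow> 'v \<Rightarrow> 'v \<Rightarrow> real" where
  "outer_curvature b m x0 x =
     1 / m x * (\<Sum>y \<in> graph_sphere b x0 (int (graph_dist b x x0) + 1). b x y)"

definition inner_curvature ::
  "('v \<Rightarrow> 'v \<Rightarrow> real) \<Rightarrow> ('v \<Rightarrow> real) \<Rightarrow> 'v \<Rightarrow> 'v \<Rightarrow> real" where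
  "inner_curvature b m x0 x =
     1 / m x * (\<Sum>y \<in> graph_sphere b x0 (int (graph_dist b x x0) - 1). b x y)"

text \<open>In a connected graph the spheres are finite, so the curvatures are genuine finite sums.\<close>

lemma (in weighted_graph) finite_sphere:
  assumes "connected_graph b"
  shows "finite (graph_sphere b x0 r)"
proof -
  have sym: "adjacent b x y \<longleftrightarrow> adjacent b y x" for x y
    by (simp add: adjacent_def weight_sym)
  have fin: "finite {y. (adjacent b ^^ n) y x0}" for n
  proof (induction n)
    case 0
    then show ?case by simp
  next
    case (Suc n)
    have "{y. (adjacent b ^^ Suc n) y x0}
        \<subseteq> (\<Union>z \<in> {z. (adjacent b ^^ n) z x0}. {y. b z y > 0})"
    proof
      fix y assume "y \<in> {y. (adjacent b ^^ Suc n) y x0}"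
      then obtain z where "adjacent b y z" "(adjacent b ^^ n) z x0"
        using relpowp_Suc_D2[of n "adjacent b" y x0] by auto
      then show "y \<in> (\<Union>z \<in> {z. (adjacent b ^^ n) z x0}. {y. b z y > 0})"
        using sym[of y z] by (auto simp: adjacent_def)
    qed
    then show ?case
      using Suc locally_finite by (meson finite_UN_I finite_subset)
  qed
  have "graph_sphere b x0 r \<subseteq> {y. (adjacent b ^^ nat r) y x0}"
  proof
    fix y assume "y \<in> graph_sphere b x0 r"
    then have "graph_dist b y x0 = nat r" by (auto simp: graph_sphere_def)
    moreover have "(adjacent b ^^ graph_dist b y x0) y x0"
      using assms unfolding connected_graph_def graph_dist_def by (metis LeastI_ex)
    ultimately show "y \<in> {y. (adjacent b ^^ nat r) y x0}" by simp
  qed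
  then show ?thesis using fin finite_subset by blast
qed


section \<open>Function spaces\<close>

definition finsupp_fun :: "('v \<Rightarrow> real) set" where
  "finsupp_fun = {f. finite {x. f x \<noteq> 0}}"

definition C0_fun :: "('v \<Rightarrow> real) set" where
  "C0_fun = {f. \<forall>e>0. \<exists>g\<in>finsupp_fun. \<forall>x. \<bar>f x - g x\<bar> \<le> e}"

definition ell2 :: "('v \<Rightarrow> real) \<Rightarrow> ('v \<Rightarrow> real) set" where
  "ell2 m = {f. (\<lambda>x. (f x)\<^sup>2 * m x) summable_on UNIV}"

definition ell2_inner :: "('v \<Rightarrow> real) \<Rightarrow> ('v \<Rightarrow> real) \<Rightarrow> ('v \<Rightarrow> real) \<Rightarrow> real" where
  "ell2_inner m f g = (\<Sum>\<^sub>\<infinity>x. f x * g x * m x)"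

definition ell2_norm :: "('v \<Rightarrow> real) \<Rightarrow> ('v \<Rightarrow> real) \<Rightarrow> real" where
  "ell2_norm m f = sqrt (ell2_inner m f f)"


section \<open>The Laplacian\<close>

definition formal_laplacian ::
  "('v \<Rightarrow> 'v \<Rightarrow> real) \<Rightarrow> ('v \<Rightarrow> real) \<Rightarrow> ('v \<Rightarrow> real) \<Rightarrow> 'v \<Rightarrow> real" where
  "formal_laplacian b m f x = 1 / m x * (\<Sum>\<^sub>\<infinity>y. b x y * (f x - f y))"

definition energy :: "('v \<Rightarrow> 'v \<Rightarrow> real) \<Rightarrow> ('v \<Rightarrow> real) \<Rightarrow> ('v \<Rightarrow> real) \<Rightarrow> real" where
  "energy b f g = 1 / 2 * (\<Sum>\<^sub>\<infinity>(x, y). b x y * (f x - f y) * (g x - g y))"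

text \<open>Green's formula: on \<^const>\<open>finsupp_fun\<close> the energy is the quadratic form of the formal
  Laplacian, so the self-adjoint operator of its closure is the Friedrichs extension.\<close>

lemma (in weighted_graph) green_formula:
  assumes "f \<in> finsupp_fun" "g \<in> finsupp_fun"
  shows "energy b f g = ell2_inner m (formal_laplacian b m f) g"
proof -
  define S where "S = {x. f x \<noteq> 0} \<union> {x. g x \<noteq> 0}"
  define V where "V = S \<union> (\<Union>x\<in>S. {y. b x y > 0})"
  have "finite S" using assms by (simp add: S_def finsupp_fun_def)
  then have V: "finite V" by (simp add: V_def locally_finite)
  have S0: "f x = 0" "g x = 0" if "x \<notin> S" for x using that by (auto simp: S_def)
  have nb: "b x y = 0" if "x \<in> S" "y \<notin> V" for x y
    using that weight_nonneg[of x y] unfolding V_def by fastforce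
  have z: "b x y * (f x - f y) * (g x - g y) = 0" if "(x, y) \<notin> V \<times> V" for x y
  proof (cases "x \<in> S \<or> y \<in> S")
    case True
    moreover have "S \<subseteq> V" by (auto simp: V_def)
    ultimately have "b x y = 0 \<or> b y x = 0" using that nb[of x y] nb[of y x] by blast
    then have "b x y = 0" using weight_sym[of x y] by linarith
    then show ?thesis by simp
  qed (simp add: S0)
  have z': "(case p of (x, y) \<Rightarrow> b x y * (f x - f y) * (g x - g y)) = 0" if "p \<notin> V \<times> V" for p
    using z that by (cases p) simp
  have "(\<Sum>\<^sub>\<infinity>(x, y). b x y * (f x - f y) * (g x - g y))
      = (\<Sum>\<^sub>\<infinity>(x, y)\<in>V \<times> V. b x y * (f x - f y) * (g x - g y))"
    by (rule infsum_cong_neutral) (use z' in blast)+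
  also have "\<dots> = (\<Sum>x\<in>V. \<Sum>y\<in>V. b x y * (f x - f y) * (g x - g y))"
    using V by (simp add: sum.cartesian_product)
  also have "\<dots> = (\<Sum>x\<in>V. \<Sum>y\<in>V. b x y * (f x - f y) * g x)
      - (\<Sum>x\<in>V. \<Sum>y\<in>V. b x y * (f x - f y) * g y)"
    by (simp add: right_diff_distrib sum_subtractf)
  also have "(\<Sum>x\<in>V. \<Sum>y\<in>V. b x y * (f x - f y) * g y)
      = (\<Sum>y\<in>V. \<Sum>x\<in>V. b x y * (f x - f y) * g y)" by (rule sum.swap)
  also have "\<dots> = (\<Sum>x\<in>V. \<Sum>y\<in>V. - (b x y * (f x - f y) * g x))"
  proof (intro sum.cong refl)
    fix x y
    show "b y x * (f y - f x) * g x = - (b x y * (f x - f y) * g x)"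
      unfolding weight_sym[of y x] by algebra
  qed
  also have "\<dots> = - (\<Sum>x\<in>V. \<Sum>y\<in>V. b x y * (f x - f y) * g x)"
    by (simp only: sum_negf)
  finally have 1: "energy b f g = (\<Sum>x\<in>V. \<Sum>y\<in>V. b x y * (f x - f y) * g x)"
    by (simp add: energy_def)
  have L: "formal_laplacian b m f x * g x * m x = (\<Sum>y\<in>V. b x y * (f x - f y) * g x)" for x
  proof (cases "x \<in> S")
    case True
    have "(\<Sum>\<^sub>\<infinity>y. b x y * (f x - f y)) = (\<Sum>\<^sub>\<infinity>y\<in>V. b x y * (f x - f y))"
      by (rule infsum_cong_neutral) (use nb True in auto)
    then show ?thesis
      using V measure_pos[of x] by (simp add: formal_laplacian_def flip: sum_distrib_right)
  qed (simp add: S0)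
  have "ell2_inner m (formal_laplacian b m f) g
      = (\<Sum>\<^sub>\<infinity>x\<in>V. formal_laplacian b m f x * g x * m x)"
    unfolding ell2_inner_def by (rule infsum_cong_neutral) (auto simp: V_def S0)
  then show ?thesis using V 1 L by simp
qed

text \<open>\<open>form_approx b m \<phi> f\<close>: the sequence \<open>\<phi>\<close> of finitely supported functions is Cauchy for the
  energy and converges to \<open>f\<close> in \<open>\<ell>\<^sup>2(X,m)\<close>. The limits \<open>f\<close> of such sequences form the domain of
  the closure of the form.\<close>

definition form_approx ::
  "('v \<Rightarrow> 'v \<Rightarrow> real) \<Rightarrow> ('v \<Rightarrow> real) \<Rightarrow> (nat \<Rightarrow> 'v \<Rightarrow> real) \<Rightarrow> ('v \<Rightarrow> real) \<Rightarrow> bool" where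
  "form_approx b m \<phi> f \<longleftrightarrow>
     f \<in> ell2 m \<and> (\<forall>n. \<phi> n \<in> finsupp_fun) \<and>
     (\<lambda>n. ell2_norm m (\<lambda>x. \<phi> n x - f x)) \<longlonglongrightarrow> 0 \<and>
     (\<forall>e>0. \<exists>N. \<forall>i\<ge>N. \<forall>j\<ge>N.
        energy b (\<lambda>x. \<phi> i x - \<phi> j x) (\<lambda>x. \<phi> i x - \<phi> j x) < e)"

definition closed_form_domain ::
  "('v \<Rightarrow> 'v \<Rightarrow> real) \<Rightarrow> ('v \<Rightarrow> real) \<Rightarrow> ('v \<Rightarrow> real) set" where
  "closed_form_domain b m = {f. \<exists>\<phi>. form_approx b m \<phi> f}"

definition closed_form ::
  "('v \<Rightarrow> 'v \<Rightarrow> real) \<Rightarrow> ('v \<Rightarrow> real) \<Rightarrow> ('v \<Rightarrow> real) \<Rightarrow> ('v \<Rightarrow> real) \<Rightarrow> real" where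
  "closed_form b m f g =
     (THE c. \<forall>\<phi> \<psi>. form_approx b m \<phi> f \<longrightarrow> form_approx b m \<psi> g \<longrightarrow>
        (\<lambda>n. energy b (\<phi> n) (\<psi> n)) \<longlonglongrightarrow> c)"

text \<open>Unbounded operators in \<open>\<ell>\<^sup>2(X,m)\<close> are represented by their graphs. The Laplacian is the
  operator of the closed form: \<open>f\<close> is in its domain with image \<open>h\<close> iff \<open>f\<close> is in the form domain and
  the closed form \<open>Q(f,g)\<close> equals \<open>\<langle>h,g\<rangle>\<close> for all \<open>g\<close> in the form domain.\<close>

definition laplacian ::
  "('v \<Rightarrow> 'v \<Rightarrow> real) \<Rightarrow> ('v \<Rightarrow> real) \<Rightarrow> (('v \<Rightarrow> real) \<times> ('v \<Rightarrow> real)) set" where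
  "laplacian b m =
     {(f, h). f \<in> closed_form_domain b m \<and> h \<in> ell2 m \<and>
        (\<forall>g \<in> closed_form_domain b m. closed_form b m f g = ell2_inner m h g)}"


section \<open>The heat semigroup\<close>

definition bounded_operator ::
  "('v \<Rightarrow> real) \<Rightarrow> (('v \<Rightarrow> real) \<Rightarrow> ('v \<Rightarrow> real)) \<Rightarrow> bool" where
  "bounded_operator m A \<longleftrightarrow>
     (\<forall>f\<in>ell2 m. A f \<in> ell2 m) \<and>
     (\<forall>f\<in>ell2 m. \<forall>g\<in>ell2 m. A (\<lambda>x. f x + g x) = (\<lambda>x. A f x + A g x)) \<and>
     (\<forall>c. \<forall>f\<in>ell2 m. A (\<lambda>x. c * f x) = (\<lambda>x. c * A f x)) \<and>
     (\<exists>C. \<forall>f\<in>ell2 m. ell2_norm m (A f) \<le> C * ell2_norm m f)"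

definition C0_semigroup ::
  "('v \<Rightarrow> real) \<Rightarrow> (real \<Rightarrow> ('v \<Rightarrow> real) \<Rightarrow> ('v \<Rightarrow> real)) \<Rightarrow> bool" where
  "C0_semigroup m T \<longleftrightarrow>
     (\<forall>t\<ge>0. bounded_operator m (T t)) \<and>
     (\<forall>f\<in>ell2 m. T 0 f = f) \<and>
     (\<forall>s\<ge>0. \<forall>t\<ge>0. \<forall>f\<in>ell2 m. T (s + t) f = T s (T t f)) \<and>
     (\<forall>f\<in>ell2 m. \<forall>t\<ge>0.
        ((\<lambda>s. ell2_norm m (\<lambda>x. T s f x - T t f x)) \<longlongrightarrow> 0) (at t within {0..}))"

definition generator ::
  "('v \<Rightarrow> real) \<Rightarrow> (real \<Rightarrow> ('v \<Rightarrow> real) \<Rightarrow> ('v \<Rightarrow> real)) \<Rightarrow>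
   (('v \<Rightarrow> real) \<times> ('v \<Rightarrow> real)) set" where
  "generator m T =
     {(f, h). f \<in> ell2 m \<and> h \<in> ell2 m \<and>
        ((\<lambda>t. ell2_norm m (\<lambda>x. (T t f x - f x) / t - h x)) \<longlongrightarrow> 0) (at_right 0)}"

text \<open>\<open>e\<^sup>-\<^sup>t\<^sup>\<Delta>\<close> is the strongly continuous semigroup on \<open>\<ell>\<^sup>2(X,m)\<close> generated by \<open>-\<Delta>\<close>. Since \<open>\<Delta>\<close> is
  nonnegative and self-adjoint, it exists, and a semigroup is determined by its generator; the
  choice operator only leaves open the irrelevant values at \<open>t < 0\<close> and outside \<open>\<ell>\<^sup>2(X,m)\<close>.\<close>

definition heat_semigroup ::
  "('v \<Rightarrow> 'v \<Rightarrow> real) \<Rightarrow> ('v \<Rightarrow> real) \<Rightarrow> real \<Rightarrow> ('v \<Rightarrow> real) \<Rightarrow> ('v \<Rightarrow> real)" where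
  "heat_semigroup b m =
     (SOME T. C0_semigroup m T \<and> generator m T = {(f, \<lambda>x. - h x) |f h. (f, h) \<in> laplacian b m})"

text \<open>\<open>p\<^sub>t(x,y)\<close> is the kernel of \<open>e\<^sup>-\<^sup>t\<^sup>\<Delta>\<close> with respect to \<open>m\<close>: testing
  \<open>P\<^sub>t f(x) = \<Sum>\<^sub>z p\<^sub>t(x,z) f(z) m(z)\<close> with \<open>f = 1\<^sub>y\<close> gives the formula below.\<close>

definition heat_kernel ::
  "('v \<Rightarrow> 'v \<Rightarrow> real) \<Rightarrow> ('v \<Rightarrow> real) \<Rightarrow> real \<Rightarrow> 'v \<Rightarrow> 'v \<Rightarrow> real" where
  "heat_kernel b m t x y = heat_semigroup b m t (indicator {y}) x / m y"

text \<open>The action of the semigroup on bounded functions.\<close>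

definition heat_operator ::
  "('v \<Rightarrow> 'v \<Rightarrow> real) \<Rightarrow> ('v \<Rightarrow> real) \<Rightarrow> real \<Rightarrow> ('v \<Rightarrow> real) \<Rightarrow> 'v \<Rightarrow> real" where
  "heat_operator b m t f x = (\<Sum>\<^sub>\<infinity>y. heat_kernel b m t x y * f y * m y)"

definition feller :: "('v \<Rightarrow> 'v \<Rightarrow> real) \<Rightarrow> ('v \<Rightarrow> real) \<Rightarrow> bool" where
  "feller b m \<longleftrightarrow> (\<forall>t\<ge>0. \<forall>f\<in>C0_fun. heat_operator b m t f \<in> C0_fun)"

end

theory Submission
  imports Defs
begin

text \<open>
  Why the theorem is true. Fix a vertex \<open>x\<close> and let \<open>\<rho> = d(-, x)\<close>. Computing the formal Laplacian
  of \<open>\<rho>\<close> gives \<open>\<kappa>\<^sub>- - \<kappa>\<^sub>+\<close>, so the curvature hypothesis with base vertex \<open>x\<close> says that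
  \<open>\<rho>\<close> is almost superharmonic: \<open>\<Delta>\<rho> \<ge> -K\<close>. In probabilistic language the process generated by
  \<open>-\<Delta>\<close> and started at \<open>x\<close> drifts away from \<open>x\<close> with speed at most \<open>K\<close>, that is
  \<open>P\<^sub>t \<rho> (x) \<le> \<rho>(x) + Kt = Kt\<close>. Markov's inequality then yields
  \<open>p\<^sub>t(x, y) m(y) d(x, y) \<le> Kt\<close> for every \<open>y\<close> (lemma \<open>transition_le_distance\<close>). The base vertex is
  the point where the kernel is evaluated, so this bound for all pairs uses the hypothesis for all base
  vertices. Balls are finite, hence \<open>p\<^sub>t(-, y)\<close> vanishes at infinity for each fixed \<open>y\<close>; since
  the kernel is nonnegative with total mass at most one, \<open>P\<^sub>t\<close> preserves \<open>C\<^sub>0(X)\<close>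
  (lemma \<open>feller_if_transition_vanishes\<close>).

  The three facts about the kernel (nonnegativity, mass at most one, the distance bound) are instances
  of one comparison principle (\<open>flow_le_supersolution\<close>): if \<open>w \<ge> 0\<close>, \<open>\<Delta>w \<ge> -K\<close> and
  \<open>v \<le> w\<close>, then \<open>P\<^sub>t v \<le> w + Kt\<close>; take \<open>w = 0\<close> and \<open>w = 1\<close>, both
  with \<open>K = 0\<close>, and \<open>w = \<rho>\<close>. The function
  \<open>w\<close> may be unbounded and far from square summable.

  The heat semigroup is characterised by its generator, so its existence has to be proved and its
  orbits have to be made accessible. Both are achieved by the implicit Euler scheme: \<open>P\<^sub>t\<close> is the
  limit of about \<open>t/h\<close> applications of the inverse of \<open>1 + h\<Delta>\<close>, along dyadic step lengths \<open>h\<close>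
  (locale \<open>m_accretive\<close>). The result of a single Euler step from \<open>f\<close> is the limit
  of every sequence of finitely supported functions that minimises the functional
  \<open>|\<phi> - f|\<^sup>2 + h Q(\<phi>)\<close>, where \<open>Q\<close> is the energy (locale \<open>friedrichs\<close>). Replacing a
  competitor \<open>\<phi>\<close> by \<open>min \<phi> w\<close> keeps the support finite, because \<open>w \<ge> 0\<close>, and lowers the
  functional whenever \<open>w + h \<Delta>w \<ge> f\<close>; so the limit lies below \<open>w\<close>
  (\<open>euler_functional_cut_le\<close>). Iterating the steps and passing to the limit gives the comparison principle.
  A dissipative generator determines its semigroup, so every semigroup generated by \<open>-\<Delta>\<close> is this limit
  (\<open>heat_semigroup_eq_flow\<close>).
\<close>

section \<open>The Hilbert space of square summable functions\<close>

text \<open>The vertex measure is absorbed into the functions (see \<open>to_l2\<close> below), so one unweighted space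
  serves all measures; making it a type gives access to the class \<^class>\<open>real_inner\<close> and to
  completeness as a class property.\<close>

typedef 'v l2 = "{f :: 'v \<Rightarrow> real. (\<lambda>x. (f x)\<^sup>2) summable_on UNIV}"
  morphisms coord Abs_l2
  by (rule exI[of _ "\<lambda>_. 0"]) simp

setup_lifting type_definition_l2

lemma square_summable_coord: "(\<lambda>x. (coord f x)\<^sup>2) summable_on UNIV"
  using coord[of f] by simp

lemma square_summable_imp_summable_prod:
  fixes f g :: "'v \<Rightarrow> real"
  assumes "(\<lambda>x. (f x)\<^sup>2) summable_on UNIV" "(\<lambda>x. (g x)\<^sup>2) summable_on UNIV"
  shows "(\<lambda>x. f x * g x) summable_on UNIV"
proof -
  have "(\<lambda>x. (f x)\<^sup>2 + (g x)\<^sup>2) summable_on UNIV"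
    by (rule summable_on_add[OF assms])
  then have "(\<lambda>x. \<bar>f x * g x\<bar>) summable_on UNIV"
  proof (rule summable_on_comparison_test)
    fix x
    have "0 \<le> (\<bar>f x\<bar> - \<bar>g x\<bar>)\<^sup>2" by simp
    then have "2 * (\<bar>f x\<bar> * \<bar>g x\<bar>) \<le> (f x)\<^sup>2 + (g x)\<^sup>2"
      by (simp add: power2_diff)
    moreover have "0 \<le> \<bar>f x\<bar> * \<bar>g x\<bar>" by simp
    ultimately show "\<bar>f x * g x\<bar> \<le> (f x)\<^sup>2 + (g x)\<^sup>2" unfolding abs_mult by linarith
  qed simp
  then show ?thesis
    using summable_on_iff_abs_summable_on_real[of "\<lambda>x. f x * g x"] by simp
qed

lemma square_summable_add:
  fixes f g :: "'v \<Rightarrow> real"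
  assumes "(\<lambda>x. (f x)\<^sup>2) summable_on UNIV" "(\<lambda>x. (g x)\<^sup>2) summable_on UNIV"
  shows "(\<lambda>x. (f x + g x)\<^sup>2) summable_on UNIV"
proof -
  have "(\<lambda>x. (f x)\<^sup>2 + (g x)\<^sup>2 + 2 * (f x * g x)) summable_on UNIV"
    by (intro summable_on_add summable_on_cmult_right assms square_summable_imp_summable_prod)
  then show ?thesis by (simp add: power2_sum mult.assoc)
qed

lemma square_summable_scale:
  fixes f :: "'v \<Rightarrow> real"
  assumes "(\<lambda>x. (f x)\<^sup>2) summable_on UNIV"
  shows "(\<lambda>x. (c * f x)\<^sup>2) summable_on UNIV"
  using summable_on_cmult_right[OF assms, of "c\<^sup>2"] by (simp add: power_mult_distrib)

instantiation l2 :: (type) real_vector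
begin

lift_definition zero_l2 :: "'a l2" is "\<lambda>_. 0" by simp
lift_definition plus_l2 :: "'a l2 \<Rightarrow> 'a l2 \<Rightarrow> 'a l2" is "\<lambda>f g x. f x + g x"
  by (rule square_summable_add)
lift_definition scaleR_l2 :: "real \<Rightarrow> 'a l2 \<Rightarrow> 'a l2" is "\<lambda>c f x. c * f x"
  by (rule square_summable_scale)
lift_definition uminus_l2 :: "'a l2 \<Rightarrow> 'a l2" is "\<lambda>f x. - f x" by simp
definition minus_l2 :: "'a l2 \<Rightarrow> 'a l2 \<Rightarrow> 'a l2" where "minus_l2 f g = f + - g"

lemma coord_simps:
  "coord 0 x = 0" "coord (f + g) x = coord f x + coord g x"
  "coord (c *\<^sub>R f) x = c * coord f x" "coord (- f) x = - coord f x"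
  "coord (f - g) x = coord f x - coord g x"
  by (simp_all add: zero_l2.rep_eq plus_l2.rep_eq scaleR_l2.rep_eq uminus_l2.rep_eq minus_l2_def)

lemma l2_eqI: "(\<And>x. coord f x = coord g x) \<Longrightarrow> f = g"
  by (simp add: coord_inject[symmetric] fun_eq_iff)

instance
  by standard (rule l2_eqI, simp add: coord_simps algebra_simps)+

end

declare coord_simps [simp]

lemmas summable_coord_prod =
  square_summable_imp_summable_prod[OF square_summable_coord square_summable_coord]

instantiation l2 :: (type) real_inner
begin

definition inner_l2 :: "'a l2 \<Rightarrow> 'a l2 \<Rightarrow> real" where
  "inner_l2 f g = (\<Sum>\<^sub>\<infinity>x. coord f x * coord g x)"
definition norm_l2 :: "'a l2 \<Rightarrow> real" where "norm_l2 f = sqrt (inner f f)"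
definition dist_l2 :: "'a l2 \<Rightarrow> 'a l2 \<Rightarrow> real" where "dist_l2 f g = norm (f - g)"
definition sgn_l2 :: "'a l2 \<Rightarrow> 'a l2" where "sgn_l2 f = f /\<^sub>R norm f"
definition uniformity_l2 :: "('a l2 \<times> 'a l2) filter" where
  "uniformity_l2 = (INF e\<in>{0<..}. principal {(x, y). dist x y < e})"
definition open_l2 :: "'a l2 set \<Rightarrow> bool" where
  "open_l2 U = (\<forall>x\<in>U. eventually (\<lambda>(x', y). x' = x \<longrightarrow> y \<in> U) uniformity)"

instance
proof
  fix f g h :: "'a l2" and r :: real
  show "inner f g = inner g f" by (simp add: inner_l2_def mult.commute)
  show "inner (f + g) h = inner f h + inner g h"
    by (simp add: inner_l2_def distrib_right infsum_add summable_coord_prod)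
  show "inner (r *\<^sub>R f) g = r * inner f g"
    by (simp add: inner_l2_def mult.assoc infsum_cmult_right')
  show "0 \<le> inner f f" by (simp add: inner_l2_def infsum_nonneg)
  show "inner f f = 0 \<longleftrightarrow> f = 0"
  proof
    assume "inner f f = 0"
    then have "coord f x * coord f x = 0" for x
      unfolding inner_l2_def
      by (intro nonneg_infsum_le_0D[of "\<lambda>x. coord f x * coord f x" UNIV])
        (simp_all add: summable_coord_prod)
    then show "f = 0" by (intro l2_eqI) simp
  qed (simp add: inner_l2_def)
qed (simp_all add: norm_l2_def dist_l2_def sgn_l2_def uniformity_l2_def open_l2_def)

end

lemma norm_square_l2: "(norm f)\<^sup>2 = (\<Sum>\<^sub>\<infinity>x. (coord f x)\<^sup>2)"
  by (simp add: power2_norm_eq_inner inner_l2_def flip: power2_eq_square)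

lemma sum_coord_square_le: "finite F \<Longrightarrow> (\<Sum>x\<in>F. (coord f x)\<^sup>2) \<le> (norm f)\<^sup>2"
  unfolding norm_square_l2 by (rule finite_sum_le_infsum) (simp_all add: square_summable_coord)

lemma abs_coord_le_norm: "\<bar>coord f x\<bar> \<le> norm f"
  using sum_coord_square_le[of "{x}" f] abs_le_square_iff[of "coord f x" "norm f"] by simp

lemma bounded_linear_coord: "bounded_linear (\<lambda>f. coord f x)"
  by (rule bounded_linear_intro[where K = 1]) (simp_all add: abs_coord_le_norm)

text \<open>Norm bounds are checked on finite sets of coordinates, where they pass to pointwise limits.
  This is how completeness and density are proved.\<close>

lemma norm_l2_le_finite_sums:
  assumes "\<And>F. finite F \<Longrightarrow> (\<Sum>x\<in>F. (coord f x)\<^sup>2) \<le> c\<^sup>2" and "0 \<le> c"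
  shows "norm f \<le> c"
proof (rule power2_le_imp_le)
  show "(norm f)\<^sup>2 \<le> c\<^sup>2"
    unfolding norm_square_l2
    by (rule infsum_le_finite_sums) (use assms in \<open>simp_all add: square_summable_coord\<close>)
qed fact

instance l2 :: (type) banach
proof
  fix X :: "nat \<Rightarrow> 'a l2"
  assume X: "Cauchy X"
  have "convergent (\<lambda>n. coord (X n) x)" for x
    using bounded_linear.Cauchy[OF bounded_linear_coord X, of x] Cauchy_convergent by blast
  then obtain f where f: "\<And>x. (\<lambda>n. coord (X n) x) \<longlonglongrightarrow> f x"
    unfolding convergent_def by metis
  \<comment> \<open>The Cauchy estimate survives on every finite set of coordinates.\<close>
  have tail: "(\<Sum>x\<in>F. (coord (X n) x - f x)\<^sup>2) \<le> e\<^sup>2"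
    if "finite F" "0 < e" and N: "\<And>i j. N \<le> i \<Longrightarrow> N \<le> j \<Longrightarrow> norm (X i - X j) < e" and "N \<le> n"
    for F e N n
  proof (rule LIMSEQ_le_const2)
    show "(\<lambda>k. \<Sum>x\<in>F. (coord (X n) x - coord (X k) x)\<^sup>2) \<longlonglongrightarrow> (\<Sum>x\<in>F. (coord (X n) x - f x)\<^sup>2)"
      by (intro tendsto_intros f)
    have "(\<Sum>x\<in>F. (coord (X n) x - coord (X k) x)\<^sup>2) \<le> e\<^sup>2" if "N \<le> k" for k
    proof -
      have "(\<Sum>x\<in>F. (coord (X n - X k) x)\<^sup>2) \<le> (norm (X n - X k))\<^sup>2"
        by (rule sum_coord_square_le) fact
      also have "\<dots> \<le> e\<^sup>2"
        using N[OF \<open>N \<le> n\<close> that] by (intro power_mono) simp_all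
      finally show ?thesis by simp
    qed
    then show "\<exists>N. \<forall>k\<ge>N. (\<Sum>x\<in>F. (coord (X n) x - coord (X k) x)\<^sup>2) \<le> e\<^sup>2" by blast
  qed
  have cauchy: "\<exists>N. \<forall>i\<ge>N. \<forall>j\<ge>N. norm (X i - X j) < e" if "0 < e" for e
    using X that unfolding Cauchy_def dist_norm by blast
  obtain N where N: "\<And>i j. N \<le> i \<Longrightarrow> N \<le> j \<Longrightarrow> norm (X i - X j) < 1"
    using cauchy[of 1] by auto
  have "bdd_above (sum (\<lambda>x. (coord (X N) x - f x)\<^sup>2) ` {F. F \<subseteq> UNIV \<and> finite F})"
    using tail[of _ 1 N N] N by (intro bdd_aboveI2[where M = 1]) simp
  then have "(\<lambda>x. (coord (X N) x - f x)\<^sup>2) summable_on UNIV"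
    by (intro nonneg_bdd_above_summable_on) simp_all
  then have "(\<lambda>x. (coord (X N) x + (-1) * (coord (X N) x - f x))\<^sup>2) summable_on UNIV"
    by (intro square_summable_add square_summable_coord square_summable_scale)
  then have "(\<lambda>x. (f x)\<^sup>2) summable_on UNIV" by simp
  then have g: "coord (Abs_l2 f) x = f x" for x by (simp add: Abs_l2_inverse)
  have "X \<longlonglongrightarrow> Abs_l2 f"
  proof (rule metric_LIMSEQ_I)
    fix e :: real assume "0 < e"
    obtain N where N: "\<And>i j. N \<le> i \<Longrightarrow> N \<le> j \<Longrightarrow> norm (X i - X j) < e / 2"
      using cauchy[of "e / 2"] \<open>0 < e\<close> by auto
    have "norm (X n - Abs_l2 f) \<le> e / 2" if "N \<le> n" for n
      using tail[of _ "e / 2" N n] N that \<open>0 < e\<close>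
      by (intro norm_l2_le_finite_sums) (simp_all add: g)
    then show "\<exists>N. \<forall>n\<ge>N. dist (X n) (Abs_l2 f) < e"
      using \<open>0 < e\<close> by (intro exI[of _ N]) (fastforce simp: dist_norm)
  qed
  then show "convergent X" unfolding convergent_def by blast
qed

lemma finite_support_dense_l2: "closure {f :: 'v l2. finite {x. coord f x \<noteq> 0}} = UNIV"
proof -
  have "\<exists>g. finite {x. coord g x \<noteq> 0} \<and> dist g f < e" if "0 < e" for f :: "'v l2" and e
  proof -
    have "(\<lambda>x. (coord f x)\<^sup>2) summable_on UNIV" by (rule square_summable_coord)
    then obtain F where F: "finite F"
      "dist (\<Sum>x\<in>F. (coord f x)\<^sup>2) (\<Sum>\<^sub>\<infinity>x. (coord f x)\<^sup>2) \<le> (e / 2)\<^sup>2"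
      using infsum_finite_approximation[of "\<lambda>x. (coord f x)\<^sup>2" UNIV "(e / 2)\<^sup>2"] \<open>0 < e\<close>
      by auto
    define g where "g = Abs_l2 (\<lambda>x. if x \<in> F then coord f x else 0)"
    have "(\<lambda>x. if x \<in> F then (coord f x)\<^sup>2 else 0) summable_on UNIV"
      using square_summable_coord[of f] by (rule summable_on_comparison_test) simp_all
    then have "(\<lambda>x. (if x \<in> F then coord f x else 0)\<^sup>2) summable_on UNIV"
      by (simp add: if_distrib[of "\<lambda>t. t\<^sup>2"] cong: if_cong)
    then have g: "coord g x = (if x \<in> F then coord f x else 0)" for x
      by (simp add: g_def Abs_l2_inverse)
    have "(\<Sum>x\<in>G. (coord (g - f) x)\<^sup>2) \<le> (e / 2)\<^sup>2" if "finite G" for G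
    proof -
      have "(\<Sum>x\<in>G. (coord (g - f) x)\<^sup>2) = (\<Sum>x\<in>G - F. (coord f x)\<^sup>2)"
        by (rule sum.mono_neutral_cong_right) (use that in \<open>auto simp: g\<close>)
      also have "\<dots> = (\<Sum>x\<in>G \<union> F. (coord f x)\<^sup>2) - (\<Sum>x\<in>F. (coord f x)\<^sup>2)"
        using that F(1) sum.subset_diff[of F "G \<union> F" "\<lambda>x. (coord f x)\<^sup>2"]
        by (simp add: Un_Diff)
      also have "(\<Sum>x\<in>G \<union> F. (coord f x)\<^sup>2) \<le> (\<Sum>\<^sub>\<infinity>x. (coord f x)\<^sup>2)"
        by (rule finite_sum_le_infsum) (use that F(1) in \<open>simp_all add: square_summable_coord\<close>)
      finally show ?thesis using F(2) by (simp add: dist_real_def)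
    qed
    then have "norm (g - f) \<le> e / 2"
      using \<open>0 < e\<close> by (intro norm_l2_le_finite_sums) simp_all
    moreover have "finite {x. coord g x \<noteq> 0}"
      using F(1) by (rule rev_finite_subset) (auto simp: g)
    ultimately show ?thesis using \<open>0 < e\<close> by (intro exI[of _ g]) (simp add: dist_norm)
  qed
  then show ?thesis by (auto simp: closure_approachable)
qed

section \<open>Strongly continuous semigroups and their generators\<close>

text \<open>Orbits of a semigroup are differentiable from the right by the definition of the generator, so the
  monotonicity criterion is needed for right derivatives. Allow a slope \<open>e > 0\<close>: past the last time
  at which \<open>g t \<le> g 0 + e t\<close> holds, the right derivative would let it hold a little longer.\<close>

lemma right_derivative_nonpos_imp_le:
  fixes g d :: "real \<Rightarrow> real"
  assumes cont: "continuous_on {0..} g"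
    and deriv: "\<And>t. 0 \<le> t \<Longrightarrow> ((\<lambda>h. (g (t + h) - g t) / h) \<longlongrightarrow> d t) (at_right 0)"
    and nonpos: "\<And>t. 0 \<le> t \<Longrightarrow> d t \<le> 0"
    and "0 \<le> t"
  shows "g t \<le> g 0"
proof -
  have "g t \<le> g 0 + e * t" if "0 < e" for e
  proof (rule ccontr)
    assume neg: "\<not> g t \<le> g 0 + e * t"
    \<comment> \<open>\<open>a\<close> is the last time before \<open>t\<close> at which the bound holds.\<close>
    define S where "S = {s \<in> {0..t}. g s - e * s \<le> g 0}"
    define a where "a = Sup S"
    have "continuous_on {0..t} (\<lambda>s. g s - e * s)"
      by (intro continuous_intros continuous_on_subset[OF cont]) auto
    then have "closed ({0..t} \<inter> (\<lambda>s. g s - e * s) -` {..g 0})"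
      by (intro continuous_closed_preimage) auto
    moreover have "S = {0..t} \<inter> (\<lambda>s. g s - e * s) -` {..g 0}" by (auto simp: S_def)
    ultimately have "closed S" by simp
    moreover have "0 \<in> S" "bdd_above S"
      using \<open>0 \<le> t\<close> by (auto simp: S_def intro: bdd_aboveI[of _ t])
    ultimately have "a \<in> S" and upper: "\<And>s. s \<in> S \<Longrightarrow> s \<le> a"
      unfolding a_def by (auto intro: closed_contains_Sup cSup_upper)
    then have "0 \<le> a" "a \<noteq> t" "a < t" using neg by (auto simp: S_def less_le)
    have "eventually (\<lambda>h. (g (a + h) - g a) / h < e) (at_right 0)"
      using deriv[OF \<open>0 \<le> a\<close>] nonpos[OF \<open>0 \<le> a\<close>] \<open>0 < e\<close> by (auto intro: order_tendstoD(2))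
    moreover have "eventually (\<lambda>h. h < t - a) (at_right 0)"
      using \<open>a < t\<close> by (intro order_tendstoD(2)[OF tendsto_ident_at]) simp
    moreover have "eventually (\<lambda>h. 0 < h) (at_right (0::real))"
      by (simp add: eventually_at_right_less)
    ultimately have "eventually (\<lambda>h. (g (a + h) - g a) / h < e \<and> h < t - a \<and> 0 < h) (at_right 0)"
      by eventually_elim simp
    then obtain h where h: "(g (a + h) - g a) / h < e" "h < t - a" "0 < h"
      using eventually_happens[of _ "at_right (0::real)"] by fastforce
    then have "g (a + h) - g a < e * h" by (simp add: pos_divide_less_eq)
    then have "a + h \<in> S"
      using h \<open>0 \<le> a\<close> \<open>a \<in> S\<close> by (auto simp: S_def algebra_simps)
    with upper[of "a + h"] \<open>0 < h\<close> show False by simp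
  qed
  then have "\<forall>\<^sub>F e in at_right 0. g t \<le> g 0 + e * t"
    using eventually_at_right_less[of 0] by (auto elim: eventually_mono)
  moreover have "((\<lambda>e. g 0 + e * t) \<longlongrightarrow> g 0 + 0 * t) (at_right 0)"
    by (intro tendsto_intros)
  ultimately show ?thesis
    using tendsto_lowerbound[of "\<lambda>e. g 0 + e * t" "g 0 + 0 * t" "at_right 0" "g t"] by simp
qed

lemma geometric_increments_imp_convergent:
  fixes X :: "nat \<Rightarrow> 'a::banach"
  assumes "\<And>j. norm (X (Suc j) - X j) \<le> c * (1/2) ^ j"
  shows "convergent X"
proof -
  have "summable (\<lambda>j. c * (1/2) ^ j)" by (intro summable_mult) simp
  then have "summable (\<lambda>j. X (Suc j) - X j)"
    by (rule summable_comparison_test'[of _ 0]) (rule assms)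
  then have "convergent (\<lambda>n. (\<Sum>j<n. X (Suc j) - X j) + X 0)"
    by (intro convergent_add convergent_const) (auto dest: summable_LIMSEQ simp: convergent_def)
  then show ?thesis by (simp add: sum_lessThan_telescope)
qed

definition strongly_continuous_semigroup ::
  "(real \<Rightarrow> 'a \<Rightarrow> 'a::real_normed_vector) \<Rightarrow> bool" where
  "strongly_continuous_semigroup T \<longleftrightarrow>
     (\<forall>t\<ge>0. bounded_linear (T t)) \<and> (\<forall>f. T 0 f = f) \<and>
     (\<forall>s\<ge>0. \<forall>t\<ge>0. \<forall>f. T (s + t) f = T s (T t f)) \<and>
     (\<forall>f. continuous_on {0..} (\<lambda>t. T t f))"

definition infinitesimal_generator ::
  "(real \<Rightarrow> 'a \<Rightarrow> 'a::real_normed_vector) \<Rightarrow> ('a \<times> 'a) set" where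
  "infinitesimal_generator T = {(f, g). ((\<lambda>t. (T t f - f) /\<^sub>R t) \<longlongrightarrow> g) (at_right 0)}"

text \<open>Orbits that start in the domain of the generator stay there, since \<open>T t\<close> is continuous and
  commutes with the difference quotients.\<close>

lemma generator_invariant:
  assumes "strongly_continuous_semigroup T" "(f, g) \<in> infinitesimal_generator T" "0 \<le> t"
  shows "(T t f, T t g) \<in> infinitesimal_generator T"
proof -
  interpret bounded_linear "T t"
    using assms by (simp add: strongly_continuous_semigroup_def)
  have "((\<lambda>s. T t ((T s f - f) /\<^sub>R s)) \<longlongrightarrow> T t g) (at_right 0)"
    using assms(2) by (intro tendsto) (simp add: infinitesimal_generator_def)
  moreover have "\<forall>\<^sub>F s in at_right 0. T t ((T s f - f) /\<^sub>R s) = (T s (T t f) - T t f) /\<^sub>R s"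
    using eventually_at_right_less[of 0]
  proof eventually_elim
    case (elim s)
    then have "T t (T s f) = T s (T t f)"
      using assms(1,3) unfolding strongly_continuous_semigroup_def
      by (metis add.commute less_imp_le)
    then show ?case by (simp add: scaleR diff)
  qed
  ultimately show ?thesis
    by (simp add: infinitesimal_generator_def tendsto_cong)
qed

text \<open>For two semigroups with the same dissipative generator \<open>B\<close>, the difference \<open>w\<close> of two orbits
  from a point of the domain solves \<open>w' = B w\<close> with \<open>w 0 = 0\<close>, and \<open>|w|\<^sup>2\<close> has right
  derivative \<open>2 (Bw, w) \<le> 0\<close>. Density of the domain extends the equality to the whole space.\<close>

lemma dissipative_generator_determines_semigroup:
  fixes S T :: "real \<Rightarrow> 'a \<Rightarrow> 'a::real_inner"
  assumes S: "strongly_continuous_semigroup S" and T: "strongly_continuous_semigroup T"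
    and gen: "infinitesimal_generator S = B" "infinitesimal_generator T = B"
    and diff: "\<And>f g f' g'. (f, g) \<in> B \<Longrightarrow> (f', g') \<in> B \<Longrightarrow> (f - f', g - g') \<in> B"
    and dissipative: "\<And>f g. (f, g) \<in> B \<Longrightarrow> inner g f \<le> 0"
    and dense: "closure (Domain B) = UNIV"
    and "0 \<le> t"
  shows "S t f = T t f"
proof -
  have on_domain: "S t f = T t f" if f: "f \<in> Domain B" for f
  proof -
    obtain g where "(f, g) \<in> B" using f by auto
    define w where "w = (\<lambda>t. S t f - T t f)"
    define w' where "w' = (\<lambda>t. S t g - T t g)"
    have inv: "(S t f, S t g) \<in> B" "(T t f, T t g) \<in> B" if "0 \<le> t" for t
      using generator_invariant[OF S, of f g t] generator_invariant[OF T, of f g t]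
        \<open>(f, g) \<in> B\<close> that gen by simp_all
    then have w: "(w t, w' t) \<in> B" if "0 \<le> t" for t
      using that unfolding w_def w'_def by (intro diff)
    have cont: "continuous_on {0..} w"
      using S T unfolding strongly_continuous_semigroup_def w_def by (auto intro: continuous_intros)
    have "(norm (w t))\<^sup>2 \<le> (norm (w 0))\<^sup>2"
    proof (rule right_derivative_nonpos_imp_le[where d = "\<lambda>t. inner (w' t) (w t + w t)"])
      show "continuous_on {0..} (\<lambda>t. (norm (w t))\<^sup>2)" by (intro continuous_intros cont)
    next
      fix t :: real assume "0 \<le> t"
      have quot: "((\<lambda>h. (w (t + h) - w t) /\<^sub>R h) \<longlongrightarrow> w' t) (at_right 0)"
      proof -
        have "((\<lambda>h. (S h (S t f) - S t f) /\<^sub>R h - (T h (T t f) - T t f) /\<^sub>R h) \<longlongrightarrow> w' t)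
          (at_right 0)"
          unfolding w'_def using inv[OF \<open>0 \<le> t\<close>] gen
          by (intro tendsto_diff) (auto simp: infinitesimal_generator_def)
        moreover have "\<forall>\<^sub>F h in at_right 0.
          (S h (S t f) - S t f) /\<^sub>R h - (T h (T t f) - T t f) /\<^sub>R h = (w (t + h) - w t) /\<^sub>R h"
          using eventually_at_right_less[of 0]
        proof eventually_elim
          case (elim h)
          then have "S h (S t f) = S (t + h) f" "T h (T t f) = T (t + h) f"
            using S T \<open>0 \<le> t\<close> unfolding strongly_continuous_semigroup_def
            by (metis add.commute less_imp_le)+
          then show ?case by (simp add: w_def algebra_simps)
        qed
        ultimately show ?thesis by (simp add: tendsto_cong)
      qed
      have shift: "((\<lambda>h. w (t + h)) \<longlongrightarrow> w t) (at_right 0)"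
      proof -
        have "(w \<longlongrightarrow> w t) (at t within {0..})"
          using cont \<open>0 \<le> t\<close> by (simp add: continuous_on_def)
        then have "(w \<longlongrightarrow> w t) (at_right t)"
          by (rule tendsto_within_subset) (use \<open>0 \<le> t\<close> in auto)
        then show ?thesis
          by (simp add: filterlim_at_right_to_0[of w _ t] add.commute)
      qed
      have "((\<lambda>h. inner ((w (t + h) - w t) /\<^sub>R h) (w (t + h) + w t)) \<longlongrightarrow> inner (w' t) (w t + w t))
        (at_right 0)"
        by (intro tendsto_intros quot shift)
      moreover have "inner ((w (t + h) - w t) /\<^sub>R h) (w (t + h) + w t)
        = ((norm (w (t + h)))\<^sup>2 - (norm (w t))\<^sup>2) / h" for h
        by (simp add: power2_norm_eq_inner inner_diff_left inner_diff_right inner_add_right inner_commute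
            divide_inverse_commute)
      ultimately show "((\<lambda>h. ((norm (w (t + h)))\<^sup>2 - (norm (w t))\<^sup>2) / h)
        \<longlongrightarrow> inner (w' t) (w t + w t)) (at_right 0)" by simp
    next
      fix t :: real assume "0 \<le> t"
      then show "inner (w' t) (w t + w t) \<le> 0"
        using dissipative[OF w] by (simp add: inner_add_right)
    qed fact
    moreover have "w 0 = 0"
      using S T by (simp add: w_def strongly_continuous_semigroup_def)
    ultimately show ?thesis by (simp add: w_def)
  qed
  have "bounded_linear (S t)" "bounded_linear (T t)"
    using S T \<open>0 \<le> t\<close> by (simp_all add: strongly_continuous_semigroup_def)
  then have "closed {f. S t f = T t f}"
    by (intro closed_Collect_eq) (simp_all add: linear_continuous_on)
  then have "closure (Domain B) \<subseteq> {f. S t f = T t f}"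
    by (rule closure_minimal[rotated]) (use on_domain in auto)
  then show ?thesis using dense by auto
qed

section \<open>The semigroup of an accretive operator by implicit Euler steps\<close>

lemma nat_floor_add:
  fixes x y :: real
  assumes "0 \<le> x" "0 \<le> y"
  shows "nat \<lfloor>x + y\<rfloor> = nat \<lfloor>x\<rfloor> + nat \<lfloor>y\<rfloor> \<or> nat \<lfloor>x + y\<rfloor> = Suc (nat \<lfloor>x\<rfloor> + nat \<lfloor>y\<rfloor>)"
  using assms by (simp add: floor_add nat_add_distrib)

text \<open>The relation \<open>A\<close> is the graph of an unbounded operator. The third assumption says that \<open>1 + hA\<close>
  is onto: the pair \<open>(u, (f - u)/h)\<close> lies in \<open>A\<close> iff \<open>u + h A u = f\<close>. Convergence rates of
  the Euler scheme are available on the domain of \<open>A\<close> squared, which is why that domain is required to be dense.\<close>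

locale m_accretive =
  fixes A :: "('a::{real_inner, banach} \<times> 'a) set"
  assumes linear_relation: "subspace A"
    and accretive: "(f, g) \<in> A \<Longrightarrow> 0 \<le> inner g f"
    and euler_step_solvable: "0 < h \<Longrightarrow> \<exists>u. (u, (f - u) /\<^sub>R h) \<in> A"
    and twice_dense: "closure {f. \<exists>g k. (f, g) \<in> A \<and> (g, k) \<in> A} = UNIV"
begin

lemma rel_add: "(f, g) \<in> A \<Longrightarrow> (f', g') \<in> A \<Longrightarrow> (f + f', g + g') \<in> A"
  using subspace_add[OF linear_relation] by fastforce

lemma rel_scale: "(f, g) \<in> A \<Longrightarrow> (c *\<^sub>R f, c *\<^sub>R g) \<in> A"
  using subspace_scale[OF linear_relation] by fastforce

lemma rel_diff: "(f, g) \<in> A \<Longrightarrow> (f', g') \<in> A \<Longrightarrow> (f - f', g - g') \<in> A"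
  using subspace_diff[OF linear_relation] by fastforce

definition step :: "real \<Rightarrow> 'a \<Rightarrow> 'a" where
  "step h f = (THE u. (u, (f - u) /\<^sub>R h) \<in> A)"

lemma step_eqI:
  assumes "0 < h" "(u, (f - u) /\<^sub>R h) \<in> A"
  shows "step h f = u"
  unfolding step_def
proof (rule the_equality)
  show "(u, (f - u) /\<^sub>R h) \<in> A" by fact
next
  fix v assume v: "(v, (f - v) /\<^sub>R h) \<in> A"
  have "0 \<le> inner ((f - v) /\<^sub>R h - (f - u) /\<^sub>R h) (v - u)"
    by (intro accretive rel_diff v assms)
  also have "(f - v) /\<^sub>R h - (f - u) /\<^sub>R h = - ((v - u) /\<^sub>R h)" by (simp add: algebra_simps)
  finally have "(norm (v - u))\<^sup>2 / h \<le> 0"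
    by (simp add: power2_norm_eq_inner divide_inverse_commute)
  then show "v = u"
    using \<open>0 < h\<close> by (simp add: divide_le_0_iff power_less_zero_eq)
qed

lemma step_rel: "0 < h \<Longrightarrow> (step h f, (f - step h f) /\<^sub>R h) \<in> A"
  using euler_step_solvable[of h f] step_eqI[of h _ f] by auto

lemma step_diff: "0 < h \<Longrightarrow> step h (f - g) = step h f - step h g"
  using rel_diff[OF step_rel[of h f] step_rel[of h g]]
  by (intro step_eqI) (simp_all add: algebra_simps)

lemma step_add: "0 < h \<Longrightarrow> step h (f + g) = step h f + step h g"
  using rel_add[OF step_rel[of h f] step_rel[of h g]]
  by (intro step_eqI) (simp_all add: algebra_simps)

lemma step_scale: "0 < h \<Longrightarrow> step h (c *\<^sub>R f) = c *\<^sub>R step h f"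
  using rel_scale[OF step_rel[of h f], of c]
  by (intro step_eqI) (simp_all add: algebra_simps)

lemma norm_step_le:
  assumes "0 < h" shows "norm (step h f) \<le> norm f"
proof -
  have "0 \<le> inner (f - step h f) (step h f)"
    using accretive[OF step_rel[OF assms, of f]] assms by (simp add: zero_le_mult_iff)
  then have "(norm (step h f))\<^sup>2 \<le> inner f (step h f)"
    by (simp add: inner_diff_left power2_norm_eq_inner)
  also have "\<dots> \<le> norm f * norm (step h f)" by (rule norm_cauchy_schwarz)
  finally have "norm (step h f) * norm (step h f) \<le> norm f * norm (step h f)"
    by (simp add: power2_eq_square)
  then show ?thesis
    by (cases "step h f = 0") simp_all
qed

text \<open>Subtracting \<open>h\<close> times the equation of the step from \<open>g = A f\<close> from the pair \<open>(f, g)\<close> leaves the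
  equation of the step from \<open>f\<close>.\<close>

lemma step_of_rel:
  assumes "0 < h" "(f, g) \<in> A"
  shows "step h f = f - h *\<^sub>R step h g" "(step h f, step h g) \<in> A"
proof -
  have "(f - h *\<^sub>R step h g, g - h *\<^sub>R ((g - step h g) /\<^sub>R h)) \<in> A"
    by (intro rel_diff rel_scale step_rel assms)
  then have "(f - h *\<^sub>R step h g, step h g) \<in> A" using \<open>0 < h\<close> by simp
  moreover from this show "step h f = f - h *\<^sub>R step h g"
    using \<open>0 < h\<close> by (intro step_eqI) simp_all
  ultimately show "(step h f, step h g) \<in> A" by simp
qed

lemma step_commute:
  assumes "0 < h" "0 < l"
  shows "step h (step l f) = step l (step h f)"
proof -
  have "(step h (step l f), step h ((f - step l f) /\<^sub>R l)) \<in> A"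
    by (intro step_of_rel step_rel assms)
  then show ?thesis
    using assms by (intro step_eqI[symmetric]) (simp_all add: step_scale step_diff)
qed

lemma
  assumes "0 < h"
  shows steps_diff: "(step h ^^ n) (f - g) = (step h ^^ n) f - (step h ^^ n) g"
    and steps_add: "(step h ^^ n) (f + g) = (step h ^^ n) f + (step h ^^ n) g"
    and steps_scale: "(step h ^^ n) (c *\<^sub>R f) = c *\<^sub>R (step h ^^ n) f"
  by (induction n) (simp_all add: step_diff step_add step_scale assms)

lemma norm_steps_le: "0 < h \<Longrightarrow> norm ((step h ^^ n) f) \<le> norm f"
  by (induction n) (simp_all add: order_trans[OF norm_step_le])

lemma norm_steps_diff_le:
  "0 < h \<Longrightarrow> norm ((step h ^^ n) f - (step h ^^ n) g) \<le> norm (f - g)"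
  using norm_steps_le[of h n "f - g"] by (simp add: steps_diff)

lemma steps_step_commute:
  "0 < h \<Longrightarrow> 0 < l \<Longrightarrow> (step h ^^ n) (step l f) = step l ((step h ^^ n) f)"
  by (induction n) (simp_all add: step_commute)

lemma norm_step_displacement:
  assumes "0 < h" "(f, g) \<in> A" shows "norm (step h f - f) \<le> h * norm g"
  using step_of_rel(1)[OF assms] norm_step_le[of h g] \<open>0 < h\<close> by (simp add: mult_left_mono)

lemma norm_steps_displacement:
  assumes "0 < h" "(f, g) \<in> A" shows "norm ((step h ^^ n) f - f) \<le> real n * h * norm g"
proof (induction n)
  case (Suc n)
  have "norm ((step h ^^ Suc n) f - f) \<le> norm (step h ((step h ^^ n) f - f)) + norm (step h f - f)"
    using norm_triangle_ineq[of "step h ((step h ^^ n) f - f)" "step h f - f"] assms(1)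
    by (simp add: step_diff)
  also have "\<dots> \<le> real n * h * norm g + h * norm g"
    using Suc norm_step_le[OF assms(1), of "(step h ^^ n) f - f"] norm_step_displacement[OF assms]
    by linarith
  finally show ?case by (simp add: algebra_simps)
qed simp

lemma norm_steps_displacement_approx:
  assumes "0 < h" "(g', k) \<in> A"
  shows "norm ((step h ^^ n) g - g) \<le> 2 * norm (g - g') + real n * h * norm k"
proof -
  have "(step h ^^ n) g - g
      = ((step h ^^ n) (g - g') - (g - g')) + ((step h ^^ n) g' - g')"
    by (simp add: steps_diff assms(1))
  also have "norm \<dots> \<le> norm ((step h ^^ n) (g - g')) + norm (g - g') + norm ((step h ^^ n) g' - g')"
    by (intro order_trans[OF norm_triangle_ineq] add_mono norm_triangle_ineq4 order_refl)
  also have "\<dots> \<le> norm (g - g') + norm (g - g') + real n * h * norm k"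
    by (intro add_mono norm_steps_le norm_steps_displacement assms order_refl)
  finally show ?thesis by simp
qed

text \<open>Each step contributes \<open>-h\<close> times a propagated copy of \<open>g = A f\<close>, so the error against the linear
  motion \<open>f - nhg\<close> is controlled by the displacement of \<open>g\<close>. As \<open>g\<close> need not be in the domain
  of \<open>A\<close>, that displacement is estimated through a nearby \<open>g'\<close> that is.\<close>

lemma norm_steps_first_order:
  assumes "0 < h" "(f, g) \<in> A" "(g', k) \<in> A"
  shows "norm ((step h ^^ n) f - f + (real n * h) *\<^sub>R g)
    \<le> real n * h * (2 * norm (g - g') + real n * h * norm k)"
proof -
  have "norm ((step h ^^ i) f - f + (real i * h) *\<^sub>R g)
    \<le> real i * h * (2 * norm (g - g') + real n * h * norm k)" if "i \<le> n" for i
    using that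
  proof (induction i)
    case (Suc i)
    have "(step h ^^ i) (step h f) = (step h ^^ i) f - h *\<^sub>R (step h ^^ Suc i) g"
      using assms by (simp add: step_of_rel(1) steps_diff steps_scale steps_step_commute)
    then have "(step h ^^ Suc i) f - f + (real (Suc i) * h) *\<^sub>R g
        = ((step h ^^ i) f - f + (real i * h) *\<^sub>R g) - h *\<^sub>R ((step h ^^ Suc i) g - g)"
      using assms by (simp add: steps_step_commute algebra_simps)
    also have "norm \<dots> \<le> norm ((step h ^^ i) f - f + (real i * h) *\<^sub>R g)
        + h * norm ((step h ^^ Suc i) g - g)"
      using norm_triangle_ineq4[of "(step h ^^ i) f - f + (real i * h) *\<^sub>R g"
        "h *\<^sub>R ((step h ^^ Suc i) g - g)"] \<open>0 < h\<close> by simp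
    also have "norm ((step h ^^ Suc i) g - g) \<le> 2 * norm (g - g') + real (Suc i) * h * norm k"
      by (rule norm_steps_displacement_approx) fact+
    also have "real (Suc i) * h * norm k \<le> real n * h * norm k"
      using Suc.prems \<open>0 < h\<close> by (intro mult_right_mono) simp_all
    also have "norm ((step h ^^ i) f - f + (real i * h) *\<^sub>R g)
        \<le> real i * h * (2 * norm (g - g') + real n * h * norm k)"
      using Suc by simp
    finally show ?case using \<open>0 < h\<close> by (simp add: algebra_simps)
  qed simp
  then show ?thesis by blast
qed

text \<open>The consistency error of the scheme: one step of length \<open>h\<close> and two of length \<open>h/2\<close> agree to
  first order, both being \<open>f - hg\<close> up to displacements of \<open>g\<close>, which are of order \<open>h\<close>.\<close>

lemma norm_half_steps:
  assumes "0 < h" "(f, g) \<in> A" "(g, k) \<in> A"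
  shows "norm (step h f - step (h / 2) (step (h / 2) f)) \<le> 2 * h\<^sup>2 * norm k"
proof -
  \<comment> \<open>Both sides are \<open>f - 2a g\<close> up to \<open>a\<close> times displacements of \<open>g\<close> of total size \<open>7a |k|\<close>.\<close>
  define a where "a = h / 2"
  have a: "0 < a" "h = 2 * a" using assms(1) by (simp_all add: a_def)
  note S = step_of_rel(1)[OF _ assms(2)]
  have d: "norm (step h g - g) \<le> h * norm k" "norm (step a g - g) \<le> a * norm k"
    "norm (step a (step a g) - g) \<le> 2 * a * norm k"
    using norm_step_displacement[OF assms(1) assms(3)] norm_step_displacement[OF a(1) assms(3)]
      norm_steps_displacement[OF a(1) assms(3), of 2] by (simp_all add: numeral_2_eq_2)
  have Sh: "step h f = f - (a *\<^sub>R step h g + a *\<^sub>R step h g)"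
    using S[OF assms(1)] a(2) by (simp flip: scaleR_add_left)
  have Saa: "step a (step a f) = f - a *\<^sub>R step a g - a *\<^sub>R step a (step a g)"
    using step_diff[OF a(1), of f "a *\<^sub>R step a g"] step_scale[OF a(1), of a "step a g"]
    by (simp flip: S[OF a(1)])
  have "step h f - step a (step a f)
      = a *\<^sub>R ((step a g - g) + (step a (step a g) - g) - 2 *\<^sub>R (step h g - g))"
    unfolding Sh Saa by (simp add: scaleR_2 algebra_simps)
  also have "norm \<dots> \<le> a * (norm (step a g - g) + norm (step a (step a g) - g)
      + 2 * norm (step h g - g))"
    using a norm_triangle_ineq4[of "(step a g - g) + (step a (step a g) - g)" "2 *\<^sub>R (step h g - g)"]
      norm_triangle_ineq[of "step a g - g" "step a (step a g) - g"] by simp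
  also have "\<dots> \<le> a * (a * norm k + 2 * a * norm k + 2 * (h * norm k))"
    using a(1) d by (intro mult_left_mono add_mono) simp_all
  also have "\<dots> = 7 * (a\<^sup>2 * norm k)" by (simp add: a(2) power2_eq_square algebra_simps)
  also have "\<dots> \<le> 8 * (a\<^sup>2 * norm k)" by (rule mult_right_mono) simp_all
  also have "\<dots> = 2 * h\<^sup>2 * norm k" by (simp add: a(2) power2_eq_square algebra_simps)
  finally show ?thesis by (simp add: a_def)
qed

text \<open>Stability turns the local error into a global one: the steps are commuting contractions, so the
  errors of the single steps add up.\<close>

lemma norm_steps_vs_half_steps:
  assumes "0 < h" "(f, g) \<in> A" "(g, k) \<in> A"
  shows "norm ((step h ^^ n) f - (step (h / 2) ^^ (2 * n)) f) \<le> real n * (2 * h\<^sup>2 * norm k)"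
proof (induction n)
  case (Suc n)
  let ?Q = "\<lambda>f. step (h / 2) (step (h / 2) f)"
  let ?X = "(step h ^^ n) f" and ?Y = "(step (h / 2) ^^ (2 * n)) f"
  have "(step h ^^ Suc n) f - (step (h / 2) ^^ (2 * Suc n)) f
      = (step h ^^ n) (step h f - ?Q f) + ?Q (?X - ?Y)"
    using assms(1) by (simp add: steps_diff step_diff steps_step_commute)
  also have "norm \<dots> \<le> norm (step h f - ?Q f) + norm (?X - ?Y)"
    using assms(1)
    by (intro order_trans[OF norm_triangle_ineq] add_mono norm_steps_le
        order_trans[OF norm_step_le norm_step_le]) simp_all
  also have "\<dots> \<le> 2 * h\<^sup>2 * norm k + real n * (2 * h\<^sup>2 * norm k)"
    by (intro add_mono Suc norm_half_steps[OF assms])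
  finally show ?case by (simp add: algebra_simps)
qed simp

definition euler :: "nat \<Rightarrow> real \<Rightarrow> 'a \<Rightarrow> 'a" where
  "euler j t f = (step (1 / 2 ^ j) ^^ nat \<lfloor>2 ^ j * t\<rfloor>) f"

lemma
  shows euler_diff: "euler j t (f - g) = euler j t f - euler j t g"
    and euler_add: "euler j t (f + g) = euler j t f + euler j t g"
    and euler_scale: "euler j t (c *\<^sub>R f) = c *\<^sub>R euler j t f"
    and norm_euler_le: "norm (euler j t f) \<le> norm f"
  by (simp_all add: euler_def steps_diff steps_add steps_scale norm_steps_le)

text \<open>There are about \<open>t/h\<close> local errors of order \<open>h\<^sup>2\<close>; rounding \<open>t\<close> to the finer grid costs at
  most one extra half step. The sum over \<open>h = 1, 1/2, 1/4, \<dots>\<close> is geometric.\<close>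

lemma euler_refine:
  assumes "(f, g) \<in> A" "(g, k) \<in> A" "0 \<le> t"
  shows "norm (euler (Suc j) t f - euler j t f) \<le> (2 * t * norm k + norm g) * (1 / 2) ^ j"
proof -
  define h :: real where "h = 1 / 2 ^ j"
  define n where "n = nat \<lfloor>2 ^ j * t\<rfloor>"
  have h: "0 < h" by (simp add: h_def)
  have "real n \<le> 2 ^ j * t" using \<open>0 \<le> t\<close> by (simp add: n_def)
  then have n: "real n * h \<le> t" by (simp add: h_def field_simps)
  have cases: "nat \<lfloor>2 ^ Suc j * t\<rfloor> = 2 * n \<or> nat \<lfloor>2 ^ Suc j * t\<rfloor> = Suc (2 * n)"
  proof -
    have double: "2 ^ Suc j * t = 2 ^ j * t + 2 ^ j * t" by simp
    show ?thesis
      unfolding double n_def mult_2 by (rule nat_floor_add) (use \<open>0 \<le> t\<close> in simp_all)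
  qed
  have half: "1 / 2 ^ Suc j = h / 2" by (simp add: h_def)
  from cases have last: "norm (euler (Suc j) t f - (step (h / 2) ^^ (2 * n)) f) \<le> h * norm g"
  proof (elim disjE)
    assume odd: "nat \<lfloor>2 ^ Suc j * t\<rfloor> = Suc (2 * n)"
    have "euler (Suc j) t f - (step (h / 2) ^^ (2 * n)) f
        = (step (h / 2) ^^ (2 * n)) (step (h / 2) f - f)"
      unfolding euler_def odd half using h by (simp add: steps_diff steps_step_commute)
    also have "norm \<dots> \<le> norm (step (h / 2) f - f)" using h by (intro norm_steps_le) simp
    also have "\<dots> \<le> h / 2 * norm g" using h by (intro norm_step_displacement assms) simp
    also have "\<dots> \<le> h * norm g" using h by (intro mult_right_mono) simp_all
    finally show ?thesis .
  next
    assume even: "nat \<lfloor>2 ^ Suc j * t\<rfloor> = 2 * n"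
    show ?thesis unfolding euler_def even half using h by simp
  qed
  have "euler (Suc j) t f - euler j t f = (euler (Suc j) t f - (step (h / 2) ^^ (2 * n)) f)
      - ((step h ^^ n) f - (step (h / 2) ^^ (2 * n)) f)"
    by (simp add: euler_def h_def n_def)
  also have "norm \<dots> \<le> h * norm g + real n * (2 * h\<^sup>2 * norm k)"
    by (rule order_trans[OF norm_triangle_ineq4
          add_mono[OF last norm_steps_vs_half_steps[OF h assms(1,2)]]])
  also have "real n * (2 * h\<^sup>2 * norm k) = (real n * h) * (2 * norm k * h)"
    by (simp add: power2_eq_square)
  also have "\<dots> \<le> t * (2 * norm k * h)"
    using h by (intro mult_right_mono n) simp
  finally show ?thesis by (simp add: h_def power_one_over field_simps)
qed

lemma twice_approx:
  assumes "0 < e"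
  obtains f' g k where "(f', g) \<in> A" "(g, k) \<in> A" "norm (f - f') < e"
proof -
  have "f \<in> closure {f. \<exists>g k. (f, g) \<in> A \<and> (g, k) \<in> A}" using twice_dense by simp
  then have "\<exists>f'\<in>{f. \<exists>g k. (f, g) \<in> A \<and> (g, k) \<in> A}. dist f' f < e"
    using assms by (simp only: closure_approachable)
  then show thesis using that by (auto simp: dist_norm norm_minus_commute)
qed

lemma euler_convergent:
  assumes "0 \<le> t" shows "convergent (\<lambda>j. euler j t f)"
proof -
  have "Cauchy (\<lambda>j. euler j t f)"
  proof (rule metric_CauchyI)
    fix e :: real assume "0 < e"
    obtain f' g k where f': "(f', g) \<in> A" "(g, k) \<in> A" "norm (f - f') < e / 3"
      by (rule twice_approx[of "e / 3" f]) (use \<open>0 < e\<close> in simp)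
    have "Cauchy (\<lambda>j. euler j t f')"
      using euler_refine[OF f'(1,2) assms]
      by (intro convergent_Cauchy geometric_increments_imp_convergent)
    then obtain N where N: "\<And>i j. N \<le> i \<Longrightarrow> N \<le> j \<Longrightarrow> dist (euler i t f') (euler j t f') < e / 3"
      using \<open>0 < e\<close> by (metis metric_CauchyD[of _ "e / 3"] zero_less_divide_iff zero_less_numeral)
    have "dist (euler i t f) (euler i t f') < e / 3" for i
      using norm_euler_le[of i t "f - f'"] f'(3) by (simp add: dist_norm euler_diff)
    then have "dist (euler i t f) (euler j t f) < e" if "N \<le> i" "N \<le> j" for i j
      using N[OF that] dist_triangle[of "euler i t f" "euler j t f" "euler i t f'"]
        dist_triangle[of "euler i t f'" "euler j t f" "euler j t f'"]
        dist_commute[of "euler j t f'" "euler j t f"] \<open>\<And>i. dist (euler i t f) (euler i t f') < e / 3\<close>[of i]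
        \<open>\<And>i. dist (euler i t f) (euler i t f') < e / 3\<close>[of j]
      by linarith
    then show "\<exists>N. \<forall>i\<ge>N. \<forall>j\<ge>N. dist (euler i t f) (euler j t f) < e" by blast
  qed
  then show ?thesis by (rule Cauchy_convergent)
qed

definition flow :: "real \<Rightarrow> 'a \<Rightarrow> 'a" where
  "flow t f = lim (\<lambda>j. euler j t f)"

lemma euler_tendsto: "0 \<le> t \<Longrightarrow> (\<lambda>j. euler j t f) \<longlonglongrightarrow> flow t f"
  using euler_convergent unfolding flow_def convergent_LIMSEQ_iff by blast

lemma
  assumes "0 \<le> t"
  shows flow_diff: "flow t (f - g) = flow t f - flow t g"
    and flow_add: "flow t (f + g) = flow t f + flow t g"
    and flow_scale: "flow t (c *\<^sub>R f) = c *\<^sub>R flow t f"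
    and norm_flow_le: "norm (flow t f) \<le> norm f"
proof -
  show "flow t (f - g) = flow t f - flow t g"
    using tendsto_diff[OF euler_tendsto euler_tendsto, OF assms assms, of f g]
    unfolding euler_diff[symmetric] using euler_tendsto[OF assms] LIMSEQ_unique by blast
  show "flow t (f + g) = flow t f + flow t g"
    using tendsto_add[OF euler_tendsto euler_tendsto, OF assms assms, of f g]
    unfolding euler_add[symmetric] using euler_tendsto[OF assms] LIMSEQ_unique by blast
  show "flow t (c *\<^sub>R f) = c *\<^sub>R flow t f"
    using tendsto_scaleR[OF tendsto_const euler_tendsto, OF assms, of c f]
    unfolding euler_scale[symmetric] using euler_tendsto[OF assms] LIMSEQ_unique by blast
  show "norm (flow t f) \<le> norm f"
    by (rule LIMSEQ_le_const2[OF tendsto_norm[OF euler_tendsto[OF assms]]])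
      (use norm_euler_le in blast)
qed

lemma flow_bounded_linear: "0 \<le> t \<Longrightarrow> bounded_linear (flow t)"
  by (rule bounded_linear_intro[where K = 1]) (simp_all add: flow_add flow_scale norm_flow_le)

lemma flow_0: "flow 0 f = f"
  using euler_tendsto[of 0 f] by (simp add: euler_def LIMSEQ_const_iff)

lemma floor_time_tendsto:
  assumes "0 \<le> t" shows "(\<lambda>j. real (nat \<lfloor>2 ^ j * t\<rfloor>) * (1 / 2 ^ j)) \<longlonglongrightarrow> t"
proof (rule tendsto_sandwich)
  have "t - (1 / 2) ^ j \<le> real (nat \<lfloor>2 ^ j * t\<rfloor>) * (1 / 2 ^ j)" for j
  proof -
    have "2 ^ j * t - 1 \<le> real (nat \<lfloor>2 ^ j * t\<rfloor>)" by linarith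
    then have "(2 ^ j * t - 1) * (1 / 2 ^ j) \<le> real (nat \<lfloor>2 ^ j * t\<rfloor>) * (1 / 2 ^ j)"
      by (intro mult_right_mono) simp_all
    then show ?thesis by (simp add: power_one_over diff_divide_distrib)
  qed
  then show "\<forall>\<^sub>F j in sequentially. t - (1 / 2) ^ j \<le> real (nat \<lfloor>2 ^ j * t\<rfloor>) * (1 / 2 ^ j)"
    by simp
  have "real (nat \<lfloor>2 ^ j * t\<rfloor>) * (1 / 2 ^ j) \<le> t" for j
  proof -
    have "real (nat \<lfloor>2 ^ j * t\<rfloor>) \<le> 2 ^ j * t" using assms by simp
    then show ?thesis by (simp add: field_simps)
  qed
  then show "\<forall>\<^sub>F j in sequentially. real (nat \<lfloor>2 ^ j * t\<rfloor>) * (1 / 2 ^ j) \<le> t" by simp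
  show "(\<lambda>j. t - (1 / 2) ^ j) \<longlonglongrightarrow> t"
    using tendsto_diff[OF tendsto_const[of t] LIMSEQ_realpow_zero[of "1 / 2"]] by simp
qed simp

lemma norm_flow_displacement_approx:
  assumes "0 \<le> t" "(g', k) \<in> A"
  shows "norm (flow t g - g) \<le> 2 * norm (g - g') + t * norm k"
proof (rule LIMSEQ_le)
  show "(\<lambda>j. norm (euler j t g - g)) \<longlonglongrightarrow> norm (flow t g - g)"
    by (intro tendsto_intros euler_tendsto assms)
  show "(\<lambda>j. 2 * norm (g - g') + real (nat \<lfloor>2 ^ j * t\<rfloor>) * (1 / 2 ^ j) * norm k)
      \<longlonglongrightarrow> 2 * norm (g - g') + t * norm k"
    by (intro tendsto_intros floor_time_tendsto assms)
  show "\<exists>N. \<forall>j\<ge>N. norm (euler j t g - g)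
      \<le> 2 * norm (g - g') + real (nat \<lfloor>2 ^ j * t\<rfloor>) * (1 / 2 ^ j) * norm k"
    unfolding euler_def by (intro exI allI impI norm_steps_displacement_approx assms) simp
qed

lemma norm_flow_first_order:
  assumes "0 \<le> t" "(f, g) \<in> A" "(g', k) \<in> A"
  shows "norm (flow t f - f + t *\<^sub>R g) \<le> t * (2 * norm (g - g') + t * norm k)"
proof (rule LIMSEQ_le)
  let ?t = "\<lambda>j. real (nat \<lfloor>2 ^ j * t\<rfloor>) * (1 / 2 ^ j)"
  show "(\<lambda>j. norm (euler j t f - f + ?t j *\<^sub>R g)) \<longlonglongrightarrow> norm (flow t f - f + t *\<^sub>R g)"
    by (intro tendsto_intros euler_tendsto floor_time_tendsto assms)
  show "(\<lambda>j. ?t j * (2 * norm (g - g') + ?t j * norm k))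
      \<longlonglongrightarrow> t * (2 * norm (g - g') + t * norm k)"
    by (intro tendsto_intros floor_time_tendsto assms)
  show "\<exists>N. \<forall>j\<ge>N. norm (euler j t f - f + ?t j *\<^sub>R g)
      \<le> ?t j * (2 * norm (g - g') + ?t j * norm k)"
    unfolding euler_def by (intro exI allI impI norm_steps_first_order assms) simp
qed

lemma dyadic_step_tendsto: "(\<lambda>j. step (1 / 2 ^ j) f) \<longlonglongrightarrow> f"
proof (rule metric_LIMSEQ_I)
  fix e :: real assume "0 < e"
  then have "0 < e / 4" by simp
  then obtain f' g k where f': "(f', g) \<in> A" "(g, k) \<in> A" "norm (f - f') < e / 4"
    by (rule twice_approx[of _ f])
  have "(\<lambda>j. (1 / 2) ^ j * norm g) \<longlonglongrightarrow> 0 * norm g"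
    by (intro tendsto_intros LIMSEQ_realpow_zero) simp_all
  then have "\<forall>\<^sub>F j in sequentially. (1 / 2) ^ j * norm g < e / 2"
    by (rule order_tendstoD(2)) (use \<open>0 < e\<close> in simp)
  then obtain N where N: "\<And>j. N \<le> j \<Longrightarrow> (1 / 2) ^ j * norm g < e / 2"
    by (auto simp: eventually_sequentially)
  have disp: "norm (step (1 / 2 ^ j) f - f) \<le> 2 * norm (f - f') + (1 / 2) ^ j * norm g" for j
    using norm_steps_displacement_approx[OF _ f'(1), of "1 / 2 ^ j" 1 f]
    by (simp add: power_one_over)
  have "dist (step (1 / 2 ^ j) f) f < e" if "N \<le> j" for j
  proof -
    have "2 * norm (f - f') < e / 2" using f'(3) by simp
    from order_le_less_trans[OF disp add_strict_mono[OF this N[OF that]]] show ?thesis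
      by (simp only: dist_norm field_sum_of_halves)
  qed
  then show "\<exists>N. \<forall>j\<ge>N. dist (step (1 / 2 ^ j) f) f < e" by blast
qed

text \<open>The rounded times for \<open>s\<close> and \<open>t\<close> add up to the rounded time for \<open>s + t\<close> or fall short by
  one step.\<close>

lemma norm_euler_add_le:
  assumes "0 \<le> s" "0 \<le> t"
  shows "norm (euler j (s + t) f - euler j s (euler j t f)) \<le> norm (step (1 / 2 ^ j) f - f)"
proof -
  define h :: real where "h = 1 / 2 ^ j"
  define n where "n = nat \<lfloor>2 ^ j * s\<rfloor> + nat \<lfloor>2 ^ j * t\<rfloor>"
  have h: "0 < h" by (simp add: h_def)
  have "nat \<lfloor>2 ^ j * (s + t)\<rfloor> = n \<or> nat \<lfloor>2 ^ j * (s + t)\<rfloor> = Suc n"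
    using nat_floor_add[of "2 ^ j * s" "2 ^ j * t"] assms by (simp add: n_def distrib_left)
  moreover have "euler j s (euler j t f) = (step h ^^ n) f"
    by (simp add: euler_def h_def n_def funpow_add)
  moreover have "norm ((step h ^^ Suc n) f - (step h ^^ n) f) \<le> norm (step h f - f)"
    using norm_steps_diff_le[OF h, of n "step h f" f] h by (simp add: steps_step_commute)
  ultimately show ?thesis by (auto simp: euler_def h_def)
qed

lemma flow_semigroup:
  assumes "0 \<le> s" "0 \<le> t"
  shows "flow (s + t) f = flow s (flow t f)"
proof -
  have "(\<lambda>j. norm (step (1 / 2 ^ j) f - f)) \<longlonglongrightarrow> 0"
    by (rule tendsto_norm_zero[OF LIM_zero[OF dyadic_step_tendsto]])
  then have "(\<lambda>j. euler j (s + t) f - euler j s (euler j t f)) \<longlonglongrightarrow> 0"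
    by (rule Lim_null_comparison[rotated]) (use norm_euler_add_le[OF assms] in simp)
  moreover have "(\<lambda>j. euler j s (euler j t f) - euler j s (flow t f)) \<longlonglongrightarrow> 0"
  proof (rule Lim_null_comparison)
    show "\<forall>\<^sub>F j in sequentially.
        norm (euler j s (euler j t f) - euler j s (flow t f)) \<le> norm (euler j t f - flow t f)"
      using norm_euler_le by (simp flip: euler_diff)
    show "(\<lambda>j. norm (euler j t f - flow t f)) \<longlonglongrightarrow> 0"
      by (rule tendsto_norm_zero[OF LIM_zero[OF euler_tendsto[OF assms(2)]]])
  qed
  ultimately have "(\<lambda>j. (euler j (s + t) f - euler j s (euler j t f))
      + (euler j s (euler j t f) - euler j s (flow t f)) + euler j s (flow t f)) \<longlonglongrightarrow> 0 + 0 + flow s (flow t f)"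
    by (intro tendsto_add euler_tendsto assms)
  then have "(\<lambda>j. euler j (s + t) f) \<longlonglongrightarrow> flow s (flow t f)" by simp
  then show ?thesis using euler_tendsto[of "s + t" f] assms LIMSEQ_unique by fastforce
qed

lemma norm_flow_diff_le:
  assumes "0 \<le> s" "0 \<le> t"
  shows "norm (flow s f - flow t f) \<le> norm (flow \<bar>s - t\<bar> f - f)"
proof -
  have *: "norm (flow (r + d) f - flow r f) \<le> norm (flow d f - f)" if "0 \<le> r" "0 \<le> d" for r d
    using norm_flow_le[OF that(1), of "flow d f - f"] that by (simp add: flow_semigroup flow_diff)
  show ?thesis
  proof (cases "t \<le> s")
    case True
    then show ?thesis using *[of t "s - t"] assms by simp
  next
    case False
    then show ?thesis using *[of s "t - s"] assms by (simp add: norm_minus_commute)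
  qed
qed

lemma flow_continuous: "continuous_on {0..} (\<lambda>t. flow t f)"
  unfolding continuous_on_iff
proof (intro ballI allI impI)
  fix t e :: real assume t: "t \<in> {0..}" and "0 < e"
  then have "0 < e / 4" by simp
  then obtain f' g k where f': "(f', g) \<in> A" "(g, k) \<in> A" "norm (f - f') < e / 4"
    by (rule twice_approx[of _ f])
  define d where "d = e / 2 / (norm g + 1)"
  have g: "0 < norm g + 1" using norm_ge_zero[of g] by linarith
  then have "0 < d" using \<open>0 < e\<close> by (simp add: d_def)
  have "dist (flow s f) (flow t f) < e" if "s \<in> {0..}" "dist s t < d" for s
  proof -
    have "norm (flow s f - flow t f) \<le> 2 * norm (f - f') + \<bar>s - t\<bar> * norm g"
      using that t
      by (intro order_trans[OF norm_flow_diff_le norm_flow_displacement_approx] f'(1)) simp_all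
    also have "\<bar>s - t\<bar> * norm g \<le> d * (norm g + 1)"
      using that \<open>0 < d\<close> by (intro mult_mono) (simp_all add: dist_real_def)
    also have "d * (norm g + 1) = e / 2" unfolding d_def using g by (simp del: divide_divide_eq_left)
    finally show ?thesis using f'(3) by (simp add: dist_norm)
  qed
  then show "\<exists>d>0. \<forall>s\<in>{0..}. dist s t < d \<longrightarrow> dist (flow s f) (flow t f) < e"
    using \<open>0 < d\<close> by blast
qed

theorem flow_strongly_continuous: "strongly_continuous_semigroup flow"
  unfolding strongly_continuous_semigroup_def
  using flow_bounded_linear flow_0 flow_semigroup flow_continuous by blast

lemma flow_derivative:
  assumes "(f, g) \<in> A" shows "(f, - g) \<in> infinitesimal_generator flow"
proof -
  have "((\<lambda>t. (flow t f - f) /\<^sub>R t) \<longlongrightarrow> - g) (at_right 0)"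
  proof (rule tendstoI)
    fix e :: real assume "0 < e"
    then have "0 < e / 4" by simp
    then obtain g' k l where g': "(g', k) \<in> A" "(k, l) \<in> A" "norm (g - g') < e / 4"
      by (rule twice_approx[of _ g])
    have "((\<lambda>t. t * norm k) \<longlongrightarrow> 0 * norm k) (at_right 0)" by (intro tendsto_intros)
    then have "\<forall>\<^sub>F t in at_right 0. t * norm k < e / 2"
      by (rule order_tendstoD(2)) (use \<open>0 < e\<close> in simp)
    then show "\<forall>\<^sub>F t in at_right 0. dist ((flow t f - f) /\<^sub>R t) (- g) < e"
      using eventually_at_right_less[of 0]
    proof eventually_elim
      case (elim t)
      have "dist ((flow t f - f) /\<^sub>R t) (- g) = norm ((flow t f - f + t *\<^sub>R g) /\<^sub>R t)"
        using elim by (simp add: dist_norm scaleR_add_right)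
      also have "\<dots> = norm (flow t f - f + t *\<^sub>R g) / t"
        unfolding norm_scaleR divide_inverse using elim by (simp add: mult.commute)
      also have "\<dots> \<le> 2 * norm (g - g') + t * norm k"
        using norm_flow_first_order[OF _ assms g'(1), of t] elim
        by (simp add: pos_divide_le_eq mult.commute)
      finally show ?case using elim g'(3) by simp
    qed
  qed
  then show ?thesis by (simp add: infinitesimal_generator_def)
qed

lemma flow_generator_dissipative:
  assumes "(f, g) \<in> infinitesimal_generator flow" shows "inner g f \<le> 0"
proof (rule tendsto_upperbound)
  show "((\<lambda>t. inner ((flow t f - f) /\<^sub>R t) f) \<longlongrightarrow> inner g f) (at_right 0)"
    using assms by (intro tendsto_intros) (simp add: infinitesimal_generator_def)
  show "\<forall>\<^sub>F t in at_right 0. inner ((flow t f - f) /\<^sub>R t) f \<le> 0"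
    using eventually_at_right_less[of 0]
  proof eventually_elim
    case (elim t)
    have "inner (flow t f) f \<le> norm (flow t f) * norm f" by (rule norm_cauchy_schwarz)
    also have "\<dots> \<le> norm f * norm f" using elim by (intro mult_right_mono norm_flow_le) simp_all
    finally have "inner (flow t f - f) f \<le> 0"
      by (simp add: inner_diff_left power2_norm_eq_inner flip: power2_eq_square)
    then show ?case using elim by (simp add: mult_nonneg_nonpos)
  qed
qed simp

text \<open>A generator that extends \<open>-A\<close> and is dissipative cannot be larger: given \<open>(f, g)\<close> in it, solve
  \<open>u + A u = f - g\<close>; then \<open>f - u\<close> is an eigenvector of the generator for the eigenvalue \<open>1\<close>,
  so it is zero.\<close>

theorem flow_generator: "infinitesimal_generator flow = {(f, - g) |f g. (f, g) \<in> A}"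
proof
  show "{(f, - g) |f g. (f, g) \<in> A} \<subseteq> infinitesimal_generator flow"
    using flow_derivative by blast
  show "infinitesimal_generator flow \<subseteq> {(f, - g) |f g. (f, g) \<in> A}"
  proof safe
    fix f g assume fg: "(f, g) \<in> infinitesimal_generator flow"
    \<comment> \<open>\<open>u\<close> solves \<open>u + A u = f - g\<close>.\<close>
    define u where "u = step 1 (f - g)"
    have u: "(u, f - g - u) \<in> A" using step_rel[of 1 "f - g"] by (simp add: u_def)
    have "((\<lambda>t. (flow t f - f) /\<^sub>R t - (flow t u - u) /\<^sub>R t) \<longlongrightarrow> g - - (f - g - u)) (at_right 0)"
      using fg flow_derivative[OF u] by (intro tendsto_diff) (simp_all add: infinitesimal_generator_def)
    moreover have "\<forall>\<^sub>F t in at_right 0.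
        (flow t f - f) /\<^sub>R t - (flow t u - u) /\<^sub>R t = (flow t (f - u) - (f - u)) /\<^sub>R t"
      using eventually_at_right_less[of 0]
      by eventually_elim (simp add: flow_diff algebra_simps)
    ultimately have "(f - u, f - u) \<in> infinitesimal_generator flow"
      by (simp add: infinitesimal_generator_def tendsto_cong)
    then have "inner (f - u) (f - u) \<le> 0" by (rule flow_generator_dissipative)
    then have "inner (f - u) (f - u) = 0" using inner_ge_zero[of "f - u"] by linarith
    then have "f = u" by simp
    then have "(f, - g) \<in> A" using u by simp
    then show "\<exists>f' g'. (f, g) = (f', - g') \<and> (f', g') \<in> A" by (intro exI[of _ f] exI[of _ "- g"]) simp
  qed
qed

theorem flow_unique:
  assumes "strongly_continuous_semigroup T"
    and "infinitesimal_generator T = {(f, - g) |f g. (f, g) \<in> A}" and "0 \<le> t"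
  shows "T t f = flow t f"
proof (rule dissipative_generator_determines_semigroup[OF assms(1) flow_strongly_continuous assms(2) flow_generator _ _ _ assms(3)])
  fix f g f' g'
  assume "(f, g) \<in> {(f, - g) |f g. (f, g) \<in> A}" "(f', g') \<in> {(f, - g) |f g. (f, g) \<in> A}"
  then show "(f - f', g - g') \<in> {(f, - g) |f g. (f, g) \<in> A}"
    using rel_diff[of f "- g" f' "- g'"] by (auto intro!: exI[of _ "g' - g"])
next
  fix f g assume "(f, g) \<in> {(f, - g) |f g. (f, g) \<in> A}"
  then show "inner g f \<le> 0" using accretive by auto
next
  have "{f. \<exists>g k. (f, g) \<in> A \<and> (g, k) \<in> A} \<subseteq> Domain {(f, - g) |f g. (f, g) \<in> A}" by auto
  from closure_mono[OF this] show "closure (Domain {(f, - g) |f g. (f, g) \<in> A}) = UNIV"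
    using twice_dense by auto
qed

end

section \<open>Friedrichs extension by minimisation\<close>

text \<open>The first order condition at the minimum of a functional that is quadratic along lines.\<close>

lemma quadratic_nonneg_imp_linear_zero:
  fixes b c :: real
  assumes "\<And>t. 0 \<le> 2 * t * b + t\<^sup>2 * c" and "0 \<le> c"
  shows "b = 0"
proof -
  \<comment> \<open>Insert \<open>t = - b / (c + 1)\<close>, which also covers \<open>c = 0\<close>.\<close>
  define d where "d = c + 1"
  have d: "0 < d" "c = d - 1" using \<open>0 \<le> c\<close> by (simp_all add: d_def)
  have "0 \<le> d\<^sup>2 * (2 * (- b / d) * b + (- b / d)\<^sup>2 * c)"
    by (intro mult_nonneg_nonneg assms(1)) simp
  also have "\<dots> = - (b\<^sup>2 * (d + 1))"
    unfolding d(2) using d(1) by (simp add: field_simps power2_eq_square)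
  finally have "b\<^sup>2 * (d + 1) \<le> 0" by simp
  then show ?thesis using d(1) by (simp add: mult_le_0_iff)
qed

text \<open>A nonnegative symmetric operator on a dense subspace that it maps into itself. Invariance puts \<open>C\<close> inside
  the domain of the square of every extension, which supplies the density needed by the Euler scheme.\<close>

locale friedrichs =
  fixes C :: "'a::{real_inner, banach} set" and L :: "'a \<Rightarrow> 'a"
  assumes subspace_C: "subspace C"
    and L_closed: "f \<in> C \<Longrightarrow> L f \<in> C"
    and L_add: "f \<in> C \<Longrightarrow> g \<in> C \<Longrightarrow> L (f + g) = L f + L g"
    and L_scale: "f \<in> C \<Longrightarrow> L (c *\<^sub>R f) = c *\<^sub>R L f"
    and L_symmetric: "f \<in> C \<Longrightarrow> g \<in> C \<Longrightarrow> inner (L f) g = inner f (L g)"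
    and L_nonneg: "f \<in> C \<Longrightarrow> 0 \<le> inner (L f) f"
    and C_dense: "closure C = UNIV"
begin

lemmas C_add = subspace_add[OF subspace_C]
lemmas C_diff = subspace_diff[OF subspace_C]
lemmas C_scale = subspace_scale[OF subspace_C]
lemmas C_0 = subspace_0[OF subspace_C]

lemma L_0: "L 0 = 0"
  using L_scale[OF C_0, of 0] by simp

definition form :: "'a \<Rightarrow> 'a \<Rightarrow> real" where "form f g = inner (L f) g"

lemma form_commute: "f \<in> C \<Longrightarrow> g \<in> C \<Longrightarrow> form f g = form g f"
  unfolding form_def using L_symmetric[of f g] inner_commute[of f "L g"] by simp

lemma form_nonneg: "f \<in> C \<Longrightarrow> 0 \<le> form f f"
  by (simp add: form_def L_nonneg)

lemma form_square_add:
  assumes "f \<in> C" "g \<in> C"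
  shows "form (f + t *\<^sub>R g) (f + t *\<^sub>R g) = form f f + 2 * t * form f g + t\<^sup>2 * form g g"
  using assms form_commute[OF assms]
  by (simp add: form_def L_add L_scale C_scale inner_add_left inner_add_right power2_eq_square
      algebra_simps)

lemma form_cauchy_schwarz:
  assumes "f \<in> C" "g \<in> C"
  shows "(form f g)\<^sup>2 \<le> form f f * form g g"
proof -
  have quad: "0 \<le> form f f + 2 * t * form f g + t\<^sup>2 * form g g" for t
    using form_nonneg[OF C_add[OF assms(1) C_scale[OF assms(2)]], of t] form_square_add[OF assms]
    by simp
  show ?thesis
  proof (cases "form g g = 0")
    case True
    have "form f g = 0"
    proof (rule ccontr)
      assume "form f g \<noteq> 0"
      then have lin: "2 * (- (form f f + 1) / (2 * form f g)) * form f g = - (form f f + 1)"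
        by simp
      show False using quad[of "- (form f f + 1) / (2 * form f g)"] unfolding lin True by simp
    qed
    then show ?thesis using True by simp
  next
    case False
    then have pos: "0 < form g g" using form_nonneg[OF assms(2)] by simp
    have "0 \<le> form g g * (form f f + 2 * (- form f g / form g g) * form f g
        + (- form f g / form g g)\<^sup>2 * form g g)"
      using pos by (intro mult_nonneg_nonneg quad) simp
    also have "\<dots> = form f f * form g g - (form f g)\<^sup>2"
      using pos by (simp add: field_simps power2_eq_square)
    finally show ?thesis by simp
  qed
qed

lemma form_add_le:
  assumes "f \<in> C" "g \<in> C"
  shows "form (f + g) (f + g) \<le> 2 * form f f + 2 * form g g"
  using form_square_add[OF assms, of 1] form_square_add[OF assms, of "-1"]
    form_nonneg[OF C_diff[OF assms]] by simp

definition form_cauchy :: "(nat \<Rightarrow> 'a) \<Rightarrow> bool" where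
  "form_cauchy \<phi> \<longleftrightarrow> (\<forall>e>0. \<exists>N. \<forall>i\<ge>N. \<forall>j\<ge>N. form (\<phi> i - \<phi> j) (\<phi> i - \<phi> j) < e)"

definition approximates :: "(nat \<Rightarrow> 'a) \<Rightarrow> 'a \<Rightarrow> bool" where
  "approximates \<phi> f \<longleftrightarrow> (\<forall>n. \<phi> n \<in> C) \<and> \<phi> \<longlonglongrightarrow> f \<and> form_cauchy \<phi>"

text \<open>The Friedrichs extension as the restriction of the adjoint of \<open>L\<close> to the form domain. Testing only
  against \<open>C\<close> avoids the closed form altogether; \<open>form_tendsto\<close> recovers its values.\<close>

definition extension :: "('a \<times> 'a) set" where
  "extension = {(f, h). (\<exists>\<phi>. approximates \<phi> f) \<and> (\<forall>\<psi>\<in>C. inner f (L \<psi>) = inner h \<psi>)}"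

lemma approximates_const: "f \<in> C \<Longrightarrow> approximates (\<lambda>_. f) f"
  by (simp add: approximates_def form_cauchy_def form_def)

lemma approximates_add:
  assumes "approximates \<phi> f" "approximates \<psi> g"
  shows "approximates (\<lambda>n. \<phi> n + \<psi> n) (f + g)"
proof -
  have C: "\<phi> n \<in> C" "\<psi> n \<in> C" for n using assms by (simp_all add: approximates_def)
  have "form_cauchy (\<lambda>n. \<phi> n + \<psi> n)"
    unfolding form_cauchy_def
  proof (intro allI impI)
    fix e :: real assume "0 < e"
    then have "0 < e / 4" by simp
    then obtain N M where
      N: "\<And>i j. N \<le> i \<Longrightarrow> N \<le> j \<Longrightarrow> form (\<phi> i - \<phi> j) (\<phi> i - \<phi> j) < e / 4" and
      M: "\<And>i j. M \<le> i \<Longrightarrow> M \<le> j \<Longrightarrow> form (\<psi> i - \<psi> j) (\<psi> i - \<psi> j) < e / 4"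
      using assms unfolding approximates_def form_cauchy_def by meson
    have "form (\<phi> i + \<psi> i - (\<phi> j + \<psi> j)) (\<phi> i + \<psi> i - (\<phi> j + \<psi> j)) < e"
      if "max N M \<le> i" "max N M \<le> j" for i j
    proof -
      have "form ((\<phi> i - \<phi> j) + (\<psi> i - \<psi> j)) ((\<phi> i - \<phi> j) + (\<psi> i - \<psi> j))
        \<le> 2 * form (\<phi> i - \<phi> j) (\<phi> i - \<phi> j) + 2 * form (\<psi> i - \<psi> j) (\<psi> i - \<psi> j)"
        by (intro form_add_le C_diff C)
      also have "\<dots> < e" using N[of i j] M[of i j] that by simp
      finally show ?thesis by (simp add: algebra_simps)
    qed
    then show "\<exists>N. \<forall>i\<ge>N. \<forall>j\<ge>N.
        form (\<phi> i + \<psi> i - (\<phi> j + \<psi> j)) (\<phi> i + \<psi> i - (\<phi> j + \<psi> j)) < e" by blast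
  qed
  then show ?thesis
    using assms C unfolding approximates_def by (auto intro: C_add tendsto_add)
qed

lemma approximates_scale:
  assumes "approximates \<phi> f"
  shows "approximates (\<lambda>n. c *\<^sub>R \<phi> n) (c *\<^sub>R f)"
proof -
  have C: "\<phi> n \<in> C" for n using assms by (simp add: approximates_def)
  have eq: "form (c *\<^sub>R \<phi> i - c *\<^sub>R \<phi> j) (c *\<^sub>R \<phi> i - c *\<^sub>R \<phi> j)
      = c\<^sup>2 * form (\<phi> i - \<phi> j) (\<phi> i - \<phi> j)" for i j
    using C by (simp add: form_def L_scale C_diff power2_eq_square flip: scaleR_diff_right)
  have "form_cauchy (\<lambda>n. c *\<^sub>R \<phi> n)"
    unfolding form_cauchy_def eq
  proof (intro allI impI)
    fix e :: real assume "0 < e"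
    have pos: "0 < c\<^sup>2 + 1" by (simp add: add_nonneg_pos)
    then have "0 < e / (c\<^sup>2 + 1)" using \<open>0 < e\<close> by simp
    then obtain N where N: "\<And>i j. N \<le> i \<Longrightarrow> N \<le> j \<Longrightarrow> form (\<phi> i - \<phi> j) (\<phi> i - \<phi> j) < e / (c\<^sup>2 + 1)"
      using assms unfolding approximates_def form_cauchy_def by meson
    have "c\<^sup>2 * form (\<phi> i - \<phi> j) (\<phi> i - \<phi> j) < e" if "N \<le> i" "N \<le> j" for i j
    proof -
      have "c\<^sup>2 * form (\<phi> i - \<phi> j) (\<phi> i - \<phi> j) \<le> (c\<^sup>2 + 1) * form (\<phi> i - \<phi> j) (\<phi> i - \<phi> j)"
        by (intro mult_right_mono form_nonneg C_diff C) simp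
      also have "\<dots> < e" using N[OF that] pos by (simp add: pos_less_divide_eq mult.commute)
      finally show ?thesis .
    qed
    then show "\<exists>N. \<forall>i\<ge>N. \<forall>j\<ge>N. c\<^sup>2 * form (\<phi> i - \<phi> j) (\<phi> i - \<phi> j) < e" by blast
  qed
  then show ?thesis
    using assms C unfolding approximates_def by (auto intro: C_scale tendsto_scaleR)
qed

lemma approximates_form_bounded:
  assumes "approximates \<phi> f"
  obtains M N where "0 < M" "\<And>n. N \<le> n \<Longrightarrow> form (\<phi> n) (\<phi> n) \<le> M"
proof -
  have C: "\<phi> n \<in> C" for n using assms by (simp add: approximates_def)
  obtain N where N: "\<And>i j. N \<le> i \<Longrightarrow> N \<le> j \<Longrightarrow> form (\<phi> i - \<phi> j) (\<phi> i - \<phi> j) < 1"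
    using assms unfolding approximates_def form_cauchy_def by (meson zero_less_one)
  have "form (\<phi> n) (\<phi> n) \<le> 2 * form (\<phi> N) (\<phi> N) + 2" if "N \<le> n" for n
    using form_add_le[OF C C_diff[OF C C], of N n N] N[OF that order_refl] by simp
  moreover have "0 < 2 * form (\<phi> N) (\<phi> N) + 2" using form_nonneg[OF C, of N] by simp
  ultimately show thesis using that by blast
qed

text \<open>The form is evaluated along arbitrary approximating sequences. Freezing \<open>\<psi> k\<close> makes
  \<open>form (\<phi> n) (\<psi> k) = (\<phi> n, L (\<psi> k))\<close> continuous in the Hilbert space norm, and the error of the
  freezing is uniformly small by the Cauchy-Schwarz inequality. The case
  \<open>f = h = 0\<close> is closability of the form.\<close>

lemma form_tendsto:
  assumes \<phi>: "approximates \<phi> f" and weak: "\<And>\<psi>. \<psi> \<in> C \<Longrightarrow> inner f (L \<psi>) = inner h \<psi>"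
    and \<psi>: "approximates \<psi> g"
  shows "(\<lambda>n. form (\<phi> n) (\<psi> n)) \<longlonglongrightarrow> inner h g"
proof (rule metric_LIMSEQ_I)
  fix e :: real assume "0 < e"
  have C: "\<phi> n \<in> C" "\<psi> n \<in> C" for n using \<phi> \<psi> by (simp_all add: approximates_def)
  obtain M N where M: "0 < M" "\<And>n. N \<le> n \<Longrightarrow> form (\<phi> n) (\<phi> n) \<le> M"
    using approximates_form_bounded[OF \<phi>] by blast
  have "0 < (e / 3)\<^sup>2 / M" using \<open>0 < e\<close> \<open>0 < M\<close> by simp
  then obtain N' where N': "\<And>i j. N' \<le> i \<Longrightarrow> N' \<le> j \<Longrightarrow>
      form (\<psi> i - \<psi> j) (\<psi> i - \<psi> j) < (e / 3)\<^sup>2 / M"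
    using \<psi> unfolding approximates_def form_cauchy_def by meson
  have "(\<lambda>k. inner h (\<psi> k)) \<longlonglongrightarrow> inner h g"
    using \<psi> by (intro tendsto_intros) (simp add: approximates_def)
  from metric_LIMSEQ_D[OF this, of "e / 3"] \<open>0 < e\<close> obtain N'' where
    N'': "\<And>k. N'' \<le> k \<Longrightarrow> dist (inner h (\<psi> k)) (inner h g) < e / 3" by auto
  define k where "k = max N' N''"
  have "(\<lambda>n. inner (\<phi> n) (L (\<psi> k))) \<longlonglongrightarrow> inner f (L (\<psi> k))"
    using \<phi> by (intro tendsto_intros) (simp add: approximates_def)
  then have "(\<lambda>n. form (\<phi> n) (\<psi> k)) \<longlonglongrightarrow> inner h (\<psi> k)"
    by (simp add: form_def L_symmetric C weak)
  from metric_LIMSEQ_D[OF this, of "e / 3"] \<open>0 < e\<close> obtain N3 where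
    N3: "\<And>n. N3 \<le> n \<Longrightarrow> dist (form (\<phi> n) (\<psi> k)) (inner h (\<psi> k)) < e / 3" by auto
  have "dist (form (\<phi> n) (\<psi> n)) (inner h g) < e" if n: "max (max N N') N3 \<le> n" for n
  proof -
    have "(form (\<phi> n) (\<psi> n - \<psi> k))\<^sup>2 \<le> form (\<phi> n) (\<phi> n) * form (\<psi> n - \<psi> k) (\<psi> n - \<psi> k)"
      by (intro form_cauchy_schwarz C C_diff)
    also have "\<dots> \<le> M * form (\<psi> n - \<psi> k) (\<psi> n - \<psi> k)"
      using n by (intro mult_right_mono M form_nonneg C_diff C) simp
    also have "\<dots> < M * ((e / 3)\<^sup>2 / M)"
      using n \<open>0 < M\<close> by (intro mult_strict_left_mono N') (simp_all add: k_def)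
    also have "\<dots> = (e / 3)\<^sup>2" using \<open>0 < M\<close> by simp
    finally have "\<bar>form (\<phi> n) (\<psi> n - \<psi> k)\<bar>\<^sup>2 < (e / 3)\<^sup>2" by (simp only: power2_abs)
    then have "\<bar>form (\<phi> n) (\<psi> n - \<psi> k)\<bar> < e / 3"
      by (rule power2_less_imp_less) (use \<open>0 < e\<close> in simp)
    then have "dist (form (\<phi> n) (\<psi> n)) (form (\<phi> n) (\<psi> k)) < e / 3"
      by (simp add: form_def inner_diff_right dist_real_def)
    moreover have "dist (form (\<phi> n) (\<psi> k)) (inner h (\<psi> k)) < e / 3" using N3 n by simp
    moreover have "dist (inner h (\<psi> k)) (inner h g) < e / 3" using N'' by (simp add: k_def)
    ultimately show ?thesis unfolding dist_real_def by linarith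
  qed
  then show "\<exists>N. \<forall>n\<ge>N. dist (form (\<phi> n) (\<psi> n)) (inner h g) < e" by blast
qed

lemma extension_C: "f \<in> C \<Longrightarrow> (f, L f) \<in> extension"
  using approximates_const by (auto simp: extension_def L_symmetric)

text \<open>Its Euler-Lagrange equation is \<open>\<phi> + h L \<phi> = f\<close>, the equation of an implicit Euler step.\<close>

definition euler_functional :: "real \<Rightarrow> 'a \<Rightarrow> 'a \<Rightarrow> real" where
  "euler_functional h f \<phi> = (norm (\<phi> - f))\<^sup>2 + h * form \<phi> \<phi>"

text \<open>The parallelogram law for the Hilbert space norm plus \<open>h\<close> times the form.\<close>

lemma euler_functional_midpoint:
  assumes "a \<in> C" "b \<in> C"
  shows "(norm (a - b))\<^sup>2 + h * form (a - b) (a - b)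
    = 2 * euler_functional h f a + 2 * euler_functional h f b
      - 4 * euler_functional h f ((1/2) *\<^sub>R (a + b))"
proof -
  have mid: "form ((1/2) *\<^sub>R (a + b)) ((1/2) *\<^sub>R (a + b)) = (1/4) * form (a + b) (a + b)"
    using assms by (simp add: form_def L_scale C_add)
  have par: "form (a + b) (a + b) + form (a - b) (a - b) = 2 * form a a + 2 * form b b"
    using form_square_add[OF assms, of 1] form_square_add[OF assms, of "-1"] by simp
  have "(1/2) *\<^sub>R (a + b) - f = (1/2) *\<^sub>R ((a - f) + (b - f))"
    by (simp add: algebra_simps flip: scaleR_2)
  then have "4 * (norm ((1/2) *\<^sub>R (a + b) - f))\<^sup>2 = (norm ((a - f) + (b - f)))\<^sup>2"
    by (simp add: power_mult_distrib power_divide)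
  moreover have "(norm ((a - f) + (b - f)))\<^sup>2 + (norm (a - b))\<^sup>2
      = 2 * (norm (a - f))\<^sup>2 + 2 * (norm (b - f))\<^sup>2"
    by (simp add: power2_norm_eq_inner inner_add_left inner_add_right inner_diff_left
        inner_diff_right inner_commute algebra_simps)
  ultimately show ?thesis
    unfolding euler_functional_def mid using arg_cong[OF par, of "\<lambda>x. h * x"]
    by (simp add: algebra_simps)
qed

text \<open>By the midpoint identity a minimising sequence is Cauchy both in norm and for the form, so its limit
  is in the form domain; the vanishing first variation in the directions of \<open>C\<close> is the equation of the
  Euler step.\<close>

lemma minimizing_sequence_tendsto:
  assumes "0 < h" and C: "\<And>n. \<phi> n \<in> C"
    and lower: "\<And>\<psi>. \<psi> \<in> C \<Longrightarrow> \<mu> \<le> euler_functional h f \<psi>"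
    and lim: "(\<lambda>n. euler_functional h f (\<phi> n)) \<longlonglongrightarrow> \<mu>"
  obtains u where "\<phi> \<longlonglongrightarrow> u" "(u, (f - u) /\<^sub>R h) \<in> extension"
proof -
  have close: "\<exists>N. \<forall>i\<ge>N. \<forall>j\<ge>N.
      (norm (\<phi> i - \<phi> j))\<^sup>2 + h * form (\<phi> i - \<phi> j) (\<phi> i - \<phi> j) < e" if "0 < e" for e
  proof -
    from metric_LIMSEQ_D[OF lim, of "e / 4"] that obtain N where
      N: "\<And>n. N \<le> n \<Longrightarrow> dist (euler_functional h f (\<phi> n)) \<mu> < e / 4" by auto
    have "(norm (\<phi> i - \<phi> j))\<^sup>2 + h * form (\<phi> i - \<phi> j) (\<phi> i - \<phi> j) < e" if "N \<le> i" "N \<le> j" for i j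
      unfolding euler_functional_midpoint[OF C C, of i j h f]
      using N[OF that(1)] N[OF that(2)] lower[OF C_scale[OF C_add[OF C C]], of "1/2" i j]
      unfolding dist_real_def by linarith
    then show ?thesis by blast
  qed
  have nonneg: "0 \<le> form (\<phi> i - \<phi> j) (\<phi> i - \<phi> j)" for i j
    by (intro form_nonneg C_diff C)
  have "Cauchy \<phi>"
  proof (rule metric_CauchyI)
    fix e :: real assume "0 < e"
    then obtain N where N: "\<And>i j. N \<le> i \<Longrightarrow> N \<le> j \<Longrightarrow>
        (norm (\<phi> i - \<phi> j))\<^sup>2 + h * form (\<phi> i - \<phi> j) (\<phi> i - \<phi> j) < e\<^sup>2"
      using close[of "e\<^sup>2"] by auto
    have "norm (\<phi> i - \<phi> j) < e" if "N \<le> i" "N \<le> j" for i j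
    proof (rule power2_less_imp_less)
      have "0 \<le> h * form (\<phi> i - \<phi> j) (\<phi> i - \<phi> j)"
        using \<open>0 < h\<close> nonneg by simp
      then show "(norm (\<phi> i - \<phi> j))\<^sup>2 < e\<^sup>2" using N[OF that] by linarith
    qed (use \<open>0 < e\<close> in simp)
    then show "\<exists>N. \<forall>i\<ge>N. \<forall>j\<ge>N. dist (\<phi> i) (\<phi> j) < e" by (auto simp: dist_norm)
  qed
  then obtain u where u: "\<phi> \<longlonglongrightarrow> u"
    using Cauchy_convergent unfolding convergent_def by blast
  have "form_cauchy \<phi>"
    unfolding form_cauchy_def
  proof (intro allI impI)
    fix e :: real assume "0 < e"
    then obtain N where N: "\<And>i j. N \<le> i \<Longrightarrow> N \<le> j \<Longrightarrow>
        (norm (\<phi> i - \<phi> j))\<^sup>2 + h * form (\<phi> i - \<phi> j) (\<phi> i - \<phi> j) < h * e"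
      using close[of "h * e"] \<open>0 < h\<close> by auto
    have "form (\<phi> i - \<phi> j) (\<phi> i - \<phi> j) < e" if "N \<le> i" "N \<le> j" for i j
    proof -
      have "h * form (\<phi> i - \<phi> j) (\<phi> i - \<phi> j) < h * e"
        using N[OF that] zero_le_power2[of "norm (\<phi> i - \<phi> j)"] by linarith
      then show ?thesis using \<open>0 < h\<close> by simp
    qed
    then show "\<exists>N. \<forall>i\<ge>N. \<forall>j\<ge>N. form (\<phi> i - \<phi> j) (\<phi> i - \<phi> j) < e" by blast
  qed
  then have approx: "approximates \<phi> u" using C u by (simp add: approximates_def)
  have "inner u (L \<psi>) = inner ((f - u) /\<^sub>R h) \<psi>" if \<psi>: "\<psi> \<in> C" for \<psi>
  proof -
    define c where "c = (norm \<psi>)\<^sup>2 + h * form \<psi> \<psi>"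
    have "inner (u - f) \<psi> + h * inner u (L \<psi>) = 0"
    proof (rule quadratic_nonneg_imp_linear_zero)
      show "0 \<le> c" using \<open>0 < h\<close> form_nonneg[OF \<psi>] by (simp add: c_def)
      fix t
      have expand: "euler_functional h f (\<phi> n + t *\<^sub>R \<psi>) = euler_functional h f (\<phi> n)
          + 2 * t * (inner (\<phi> n - f) \<psi> + h * inner (\<phi> n) (L \<psi>)) + t\<^sup>2 * c" for n
      proof -
        have "(norm (\<phi> n + t *\<^sub>R \<psi> - f))\<^sup>2
            = (norm (\<phi> n - f))\<^sup>2 + 2 * t * inner (\<phi> n - f) \<psi> + t\<^sup>2 * (norm \<psi>)\<^sup>2"
          unfolding power2_norm_eq_inner
          by (simp add: inner_add_left inner_add_right inner_diff_left
              inner_diff_right inner_commute power2_eq_square algebra_simps)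
        moreover have "form (\<phi> n) \<psi> = inner (\<phi> n) (L \<psi>)"
          by (simp add: form_def L_symmetric C \<psi>)
        ultimately show ?thesis
          unfolding euler_functional_def c_def form_square_add[OF C \<psi>]
          by (simp add: algebra_simps)
      qed
      have "(\<lambda>n. euler_functional h f (\<phi> n)
          + 2 * t * (inner (\<phi> n - f) \<psi> + h * inner (\<phi> n) (L \<psi>)) + t\<^sup>2 * c)
        \<longlonglongrightarrow> \<mu> + 2 * t * (inner (u - f) \<psi> + h * inner u (L \<psi>)) + t\<^sup>2 * c"
        by (intro tendsto_intros lim u)
      then have "\<mu> \<le> \<mu> + 2 * t * (inner (u - f) \<psi> + h * inner u (L \<psi>)) + t\<^sup>2 * c"
        unfolding expand[symmetric]
        by (rule LIMSEQ_le_const) (use lower[OF C_add[OF C C_scale[OF \<psi>]]] in blast)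
      then show "0 \<le> 2 * t * (inner (u - f) \<psi> + h * inner u (L \<psi>)) + t\<^sup>2 * c" by simp
    qed
    then have "inner u (L \<psi>) = - inner (u - f) \<psi> / h"
      using \<open>0 < h\<close> by (simp add: field_simps)
    then show ?thesis
      by (simp add: inner_diff_left divide_inverse_commute algebra_simps)
  qed
  then have "(u, (f - u) /\<^sub>R h) \<in> extension"
    using approx by (auto simp: extension_def)
  then show thesis using that u by blast
qed

lemma minimizing_sequence_exists:
  assumes "0 < h"
  obtains \<mu> \<phi> where "\<And>n. \<phi> n \<in> C" "\<And>\<psi>. \<psi> \<in> C \<Longrightarrow> \<mu> \<le> euler_functional h f \<psi>"
    "(\<lambda>n. euler_functional h f (\<phi> n)) \<longlonglongrightarrow> \<mu>"
proof -
  define \<mu> where "\<mu> = Inf (euler_functional h f ` C)"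
  have nonneg: "0 \<le> euler_functional h f \<psi>" if "\<psi> \<in> C" for \<psi>
    using assms form_nonneg[OF that] by (simp add: euler_functional_def)
  then have bdd: "bdd_below (euler_functional h f ` C)" by (auto intro: bdd_belowI[of _ 0])
  then have lower: "\<mu> \<le> euler_functional h f \<psi>" if "\<psi> \<in> C" for \<psi>
    using that by (simp add: \<mu>_def cInf_lower)
  have "\<exists>\<psi>\<in>C. euler_functional h f \<psi> < \<mu> + 1 / real (Suc n)" for n
    using cInf_lessD[of "euler_functional h f ` C" "\<mu> + 1 / real (Suc n)"] C_0
    by (auto simp: \<mu>_def)
  then obtain \<phi> where \<phi>: "\<And>n. \<phi> n \<in> C" "\<And>n. euler_functional h f (\<phi> n) < \<mu> + 1 / real (Suc n)"
    by metis
  have "(\<lambda>n. euler_functional h f (\<phi> n)) \<longlonglongrightarrow> \<mu>"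
  proof (rule tendsto_sandwich[OF _ _ tendsto_const])
    show "\<forall>\<^sub>F n in sequentially. \<mu> \<le> euler_functional h f (\<phi> n)"
      by (intro always_eventually allI lower \<phi>)
    show "\<forall>\<^sub>F n in sequentially. euler_functional h f (\<phi> n) \<le> \<mu> + 1 / real (Suc n)"
      by (intro always_eventually allI less_imp_le \<phi>)
    show "(\<lambda>n. \<mu> + 1 / real (Suc n)) \<longlonglongrightarrow> \<mu>"
      using tendsto_add[OF tendsto_const[of \<mu>] LIMSEQ_Suc[OF lim_1_over_n]] by simp
  qed
  then show thesis using that \<phi>(1) lower by blast
qed

sublocale m_accretive extension
proof
  show "subspace extension"
    unfolding subspace_def
  proof (intro conjI ballI allI)
    show "0 \<in> extension"
      using extension_C[OF C_0] by (simp add: L_0 zero_prod_def)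
  next
    fix x y assume "x \<in> extension" "y \<in> extension"
    then show "x + y \<in> extension"
      using approximates_add by (fastforce simp: extension_def inner_add_left)
  next
    fix c x assume "x \<in> extension"
    then show "c *\<^sub>R x \<in> extension"
      using approximates_scale by (fastforce simp: extension_def)
  qed
next
  fix f g assume "(f, g) \<in> extension"
  then obtain \<phi> where \<phi>: "approximates \<phi> f" and weak: "\<And>\<psi>. \<psi> \<in> C \<Longrightarrow> inner f (L \<psi>) = inner g \<psi>"
    by (auto simp: extension_def)
  have "0 \<le> form (\<phi> n) (\<phi> n)" for n
    using \<phi> by (intro form_nonneg) (simp add: approximates_def)
  then show "0 \<le> inner g f"
    by (intro LIMSEQ_le_const[OF form_tendsto[OF \<phi> weak \<phi>]]) auto
next
  fix h :: real and f assume "0 < h"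
  then show "\<exists>u. (u, (f - u) /\<^sub>R h) \<in> extension"
    by (metis minimizing_sequence_exists minimizing_sequence_tendsto)
next
  have "C \<subseteq> {f. \<exists>g k. (f, g) \<in> extension \<and> (g, k) \<in> extension}"
    using extension_C L_closed by blast
  from closure_mono[OF this] show "closure {f. \<exists>g k. (f, g) \<in> extension \<and> (g, k) \<in> extension} = UNIV"
    using C_dense by auto
qed

text \<open>Any minimising sequence converges to the Euler step, so one may choose it inside \<open>S\<close>.\<close>

lemma step_mem_closed:
  assumes "0 < h" "closed S"
    and improve: "\<And>\<phi>. \<phi> \<in> C \<Longrightarrow>
      \<exists>\<psi>\<in>C. \<psi> \<in> S \<and> euler_functional h f \<psi> \<le> euler_functional h f \<phi>"
  shows "step h f \<in> S"
proof -
  obtain \<mu> \<phi> where C: "\<And>n. \<phi> n \<in> C"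
    and lower: "\<And>\<psi>. \<psi> \<in> C \<Longrightarrow> \<mu> \<le> euler_functional h f \<psi>"
    and lim: "(\<lambda>n. euler_functional h f (\<phi> n)) \<longlonglongrightarrow> \<mu>"
    by (rule minimizing_sequence_exists[OF assms(1), of f]) blast
  obtain \<psi> where \<psi>: "\<And>n. \<psi> n \<in> C" "\<And>n. \<psi> n \<in> S"
    "\<And>n. euler_functional h f (\<psi> n) \<le> euler_functional h f (\<phi> n)"
    using improve[OF C] by metis
  have "(\<lambda>n. euler_functional h f (\<psi> n)) \<longlonglongrightarrow> \<mu>"
    by (rule tendsto_sandwich[OF _ _ tendsto_const lim])
      (intro always_eventually allI lower \<psi>)+
  from minimizing_sequence_tendsto[OF assms(1) \<psi>(1) lower this]
  obtain u where "\<psi> \<longlonglongrightarrow> u" "(u, (f - u) /\<^sub>R h) \<in> extension" by blast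
  then show ?thesis
    using step_eqI[OF assms(1)] closed_sequentially[OF assms(2)] \<psi>(2) by metis
qed

end

section \<open>The graph Laplacian as a Friedrichs extension\<close>

context weighted_graph begin

text \<open>Multiplication by the square root of the measure is an isometry from the weighted space onto
  the unweighted one; \<open>of_l2\<close> is its inverse.\<close>

definition
  "to_l2 f = Abs_l2 (\<lambda>x. f x * sqrt (m x))"

definition
  "of_l2 v = (\<lambda>x. coord v x / sqrt (m x))"

lemma sqrt_measure_pos: "0 < sqrt (m x)"
  by (simp add: measure_pos)

lemma measure_simps [simp]: "m x \<noteq> 0" "\<bar>m x\<bar> = m x"
  using measure_pos[of x] by simp_all

lemma coord_eq_of_l2: "coord v x = of_l2 v x * sqrt (m x)"
  by (simp add: of_l2_def)

lemma coord_to_l2: "f \<in> ell2 m \<Longrightarrow> coord (to_l2 f) x = f x * sqrt (m x)"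
  using measure_pos
  by (simp add: to_l2_def ell2_def Abs_l2_inverse power_mult_distrib less_imp_le)

lemma of_to_l2: "f \<in> ell2 m \<Longrightarrow> of_l2 (to_l2 f) = f"
  by (simp add: of_l2_def coord_to_l2)

lemma of_l2_in_ell2: "of_l2 v \<in> ell2 m"
  using square_summable_coord[of v] measure_pos
  by (simp add: ell2_def coord_eq_of_l2 power_mult_distrib less_imp_le)

lemma to_of_l2: "to_l2 (of_l2 v) = v"
  by (rule l2_eqI) (simp add: coord_eq_of_l2 of_to_l2 of_l2_in_ell2)

lemma of_l2_simps [simp]:
  "of_l2 0 x = 0" "of_l2 (v + w) x = of_l2 v x + of_l2 w x"
  "of_l2 (v - w) x = of_l2 v x - of_l2 w x" "of_l2 (c *\<^sub>R v) x = c * of_l2 v x"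
  "of_l2 (- v) x = - of_l2 v x"
  by (simp_all add: of_l2_def add_divide_distrib diff_divide_distrib)

lemma of_l2_fun:
  "of_l2 (v + w) = (\<lambda>x. of_l2 v x + of_l2 w x)" "of_l2 (c *\<^sub>R v) = (\<lambda>x. c * of_l2 v x)"
  "of_l2 (v - w) = (\<lambda>x. of_l2 v x - of_l2 w x)"
  by auto

lemma of_l2_eq_iff: "of_l2 v = of_l2 w \<longleftrightarrow> v = w"
  using to_of_l2 by metis

lemma to_l2_eqI: "(\<And>x. of_l2 v x = f x) \<Longrightarrow> to_l2 f = v"
  using to_of_l2[of v] by (metis ext)

lemma in_ell2_eqI: "(\<And>x. of_l2 v x = f x) \<Longrightarrow> f \<in> ell2 m"
  using of_l2_in_ell2[of v] by (metis ext)

lemma inner_eq_ell2_inner: "inner v w = ell2_inner m (of_l2 v) (of_l2 w)"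
proof -
  have "coord v x * coord w x = of_l2 v x * of_l2 w x * m x" for x
    by (simp add: coord_eq_of_l2 mult_ac)
  then show ?thesis by (simp add: inner_l2_def ell2_inner_def)
qed

lemma norm_eq_ell2_norm: "norm v = ell2_norm m (of_l2 v)"
  by (simp add: ell2_norm_def norm_eq_sqrt_inner inner_eq_ell2_inner)


lemma finsupp_in_ell2: "f \<in> finsupp_fun \<Longrightarrow> f \<in> ell2 m"
proof -
  assume "f \<in> finsupp_fun"
  then have "finite {x. f x \<noteq> 0}" by (simp add: finsupp_fun_def)
  then have "(\<lambda>x. (f x)\<^sup>2 * m x) summable_on {x. f x \<noteq> 0}" by simp
  then show "f \<in> ell2 m"
    unfolding ell2_def mem_Collect_eq
    by (rule summable_on_cong_neutral[THEN iffD1, rotated -1]) auto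
qed

definition "finsupp_l2 = {v. of_l2 v \<in> finsupp_fun}"

lemma finsupp_l2_iff: "v \<in> finsupp_l2 \<longleftrightarrow> of_l2 v \<in> finsupp_fun"
  by (simp add: finsupp_l2_def)

lemma finsupp_l2_coord: "finsupp_l2 = {v. finite {x. coord v x \<noteq> 0}}"
  by (simp add: finsupp_l2_def finsupp_fun_def of_l2_def)

lemma to_l2_finsupp: "f \<in> finsupp_fun \<Longrightarrow> to_l2 f \<in> finsupp_l2"
  by (simp add: finsupp_l2_iff of_to_l2 finsupp_in_ell2)

lemma formal_laplacian_eq_sum:
  "formal_laplacian b m f x = 1 / m x * (\<Sum>y\<in>{y. b x y > 0}. b x y * (f x - f y))"
proof -
  have "b x y = 0" if "\<not> b x y > 0" for y using weight_nonneg[of x y] that by simp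
  then have "(\<Sum>\<^sub>\<infinity>y. b x y * (f x - f y)) = (\<Sum>\<^sub>\<infinity>y\<in>{y. b x y > 0}. b x y * (f x - f y))"
    by (intro infsum_cong_neutral) auto
  then show ?thesis by (simp add: formal_laplacian_def locally_finite)
qed

lemma formal_laplacian_add:
  "formal_laplacian b m (\<lambda>x. f x + g x) x = formal_laplacian b m f x + formal_laplacian b m g x"
  by (simp add: formal_laplacian_eq_sum sum.distrib algebra_simps flip: distrib_left)
     (simp add: add_divide_distrib diff_divide_distrib sum.distrib sum_subtractf algebra_simps)

lemma formal_laplacian_scale:
  "formal_laplacian b m (\<lambda>x. c * f x) x = c * formal_laplacian b m f x"
  by (simp add: formal_laplacian_eq_sum sum_distrib_left algebra_simps)

lemma formal_laplacian_add_const: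
  "formal_laplacian b m (\<lambda>x. f x + c) x = formal_laplacian b m f x"
  by (simp add: formal_laplacian_eq_sum)

lemma formal_laplacian_finsupp:
  assumes "f \<in> finsupp_fun" shows "formal_laplacian b m f \<in> finsupp_fun"
proof -
  let ?S = "{x. f x \<noteq> 0}"
  have "{x. formal_laplacian b m f x \<noteq> 0} \<subseteq> ?S \<union> (\<Union>x\<in>?S. {y. b x y > 0})"
  proof
    fix x assume "x \<in> {x. formal_laplacian b m f x \<noteq> 0}"
    then have "(\<Sum>y\<in>{y. b x y > 0}. b x y * (f x - f y)) \<noteq> 0"
      by (simp add: formal_laplacian_eq_sum)
    then obtain y where "b x y > 0" "f x - f y \<noteq> 0"
      by (metis (mono_tags, lifting) mem_Collect_eq mult_zero_right sum.neutral)
    then show "x \<in> ?S \<union> (\<Union>x\<in>?S. {y. b x y > 0})"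
      using weight_sym[of x y] by auto
  qed
  then show ?thesis
    using assms locally_finite by (auto simp: finsupp_fun_def intro: finite_subset)
qed

definition "lap v = to_l2 (formal_laplacian b m (of_l2 v))"

lemma of_l2_lap: "v \<in> finsupp_l2 \<Longrightarrow> of_l2 (lap v) = formal_laplacian b m (of_l2 v)"
  by (simp add: lap_def of_to_l2 finsupp_in_ell2 formal_laplacian_finsupp finsupp_l2_iff)

lemma inner_lap_eq_energy:
  assumes "v \<in> finsupp_l2" "w \<in> finsupp_l2"
  shows "inner (lap v) w = energy b (of_l2 v) (of_l2 w)"
  using assms by (simp add: inner_eq_ell2_inner of_l2_lap green_formula finsupp_l2_iff)

lemma energy_commute: "energy b f g = energy b g f"
  by (simp add: energy_def mult_ac)

lemma energy_nonneg: "0 \<le> energy b f f"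
  unfolding energy_def
  by (intro mult_nonneg_nonneg infsum_nonneg)
    (auto simp: mult.assoc weight_nonneg)

sublocale heat: friedrichs finsupp_l2 lap
proof
  show "subspace finsupp_l2"
    unfolding subspace_def
  proof (intro conjI ballI allI)
    show "0 \<in> finsupp_l2" by (simp add: finsupp_l2_coord)
  next
    fix v w assume "v \<in> finsupp_l2" "w \<in> finsupp_l2"
    then have "finite ({x. coord v x \<noteq> 0} \<union> {x. coord w x \<noteq> 0})" by (simp add: finsupp_l2_coord)
    then show "v + w \<in> finsupp_l2"
      unfolding finsupp_l2_coord mem_Collect_eq by (rule rev_finite_subset) auto
  next
    fix c v assume "v \<in> finsupp_l2"
    then show "c *\<^sub>R v \<in> finsupp_l2"
      unfolding finsupp_l2_coord mem_Collect_eq by (rule rev_finite_subset) auto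
  qed
  show "closure finsupp_l2 = UNIV"
    unfolding finsupp_l2_coord by (rule finite_support_dense_l2)
next
  fix v w c assume v: "v \<in> finsupp_l2"
  show "lap v \<in> finsupp_l2"
    using v by (simp add: finsupp_l2_iff of_l2_lap formal_laplacian_finsupp)
  show "lap (c *\<^sub>R v) = c *\<^sub>R lap v"
  proof -
    have "of_l2 (c *\<^sub>R lap v) x = formal_laplacian b m (of_l2 (c *\<^sub>R v)) x" for x
      by (simp add: of_l2_lap[OF v] of_l2_fun formal_laplacian_scale)
    then show ?thesis unfolding lap_def[of "c *\<^sub>R v"] by (rule to_l2_eqI)
  qed
  show "0 \<le> inner (lap v) v" by (simp add: inner_lap_eq_energy v energy_nonneg)
  assume w: "w \<in> finsupp_l2"
  show "lap (v + w) = lap v + lap w"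
  proof -
    have "of_l2 (lap v + lap w) x = formal_laplacian b m (of_l2 (v + w)) x" for x
      using v w by (simp add: of_l2_lap of_l2_fun formal_laplacian_add)
    then show ?thesis unfolding lap_def[of "v + w"] by (rule to_l2_eqI)
  qed
  show "inner (lap v) w = inner v (lap w)"
    using v w by (simp add: inner_lap_eq_energy inner_commute[of v] energy_commute)
qed

lemma form_eq_energy:
  "v \<in> finsupp_l2 \<Longrightarrow> w \<in> finsupp_l2 \<Longrightarrow> heat.form v w = energy b (of_l2 v) (of_l2 w)"
  by (simp add: heat.form_def inner_lap_eq_energy)

section \<open>The heat semigroup as a limit of Euler steps\<close>

text \<open>The isometry turns the approximating sequences of the closed form into those of the abstract Friedrichs
  construction.\<close>

lemma form_approx_iff:
  "form_approx b m \<phi> f \<longleftrightarrow>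
     f \<in> ell2 m \<and> (\<forall>n. \<phi> n \<in> finsupp_fun) \<and> heat.approximates (\<lambda>n. to_l2 (\<phi> n)) (to_l2 f)"
proof (cases "f \<in> ell2 m \<and> (\<forall>n. \<phi> n \<in> finsupp_fun)")
  case True
  then have C: "to_l2 (\<phi> n) \<in> finsupp_l2" "of_l2 (to_l2 (\<phi> n)) = \<phi> n" for n
    by (simp_all add: to_l2_finsupp of_to_l2 finsupp_in_ell2)
  have "ell2_norm m (\<lambda>x. \<phi> n x - f x) = norm (to_l2 (\<phi> n) - to_l2 f)" for n
    using True by (simp add: norm_eq_ell2_norm of_l2_fun C of_to_l2)
  then have lim: "(\<lambda>n. ell2_norm m (\<lambda>x. \<phi> n x - f x)) \<longlonglongrightarrow> 0 \<longleftrightarrow> (\<lambda>n. to_l2 (\<phi> n)) \<longlonglongrightarrow> to_l2 f"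
    by (simp add: tendsto_norm_zero_iff LIM_zero_iff)
  have "energy b (\<lambda>x. \<phi> i x - \<phi> j x) (\<lambda>x. \<phi> i x - \<phi> j x)
      = heat.form (to_l2 (\<phi> i) - to_l2 (\<phi> j)) (to_l2 (\<phi> i) - to_l2 (\<phi> j))" for i j
    by (simp add: form_eq_energy heat.C_diff C of_l2_fun)
  then show ?thesis
    using True lim C(1) by (simp add: form_approx_def heat.approximates_def heat.form_cauchy_def)
qed (auto simp: form_approx_def)

lemma form_domain_iff:
  "f \<in> closed_form_domain b m \<longleftrightarrow> f \<in> ell2 m \<and> (\<exists>\<Phi>. heat.approximates \<Phi> (to_l2 f))"
proof
  assume "f \<in> ell2 m \<and> (\<exists>\<Phi>. heat.approximates \<Phi> (to_l2 f))"
  then obtain \<Phi> where "f \<in> ell2 m" and \<Phi>: "heat.approximates \<Phi> (to_l2 f)" by blast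
  then have "form_approx b m (\<lambda>n. of_l2 (\<Phi> n)) f"
    by (simp add: form_approx_iff to_of_l2 heat.approximates_def finsupp_l2_iff)
  then show "f \<in> closed_form_domain b m" by (auto simp: closed_form_domain_def)
qed (auto simp: closed_form_domain_def form_approx_iff)

lemma closed_form_eq:
  assumes f: "(to_l2 f, v) \<in> heat.extension" "f \<in> closed_form_domain b m"
    and g: "g \<in> closed_form_domain b m"
  shows "closed_form b m f g = inner v (to_l2 g)"
proof -
  have lim: "(\<lambda>n. energy b (\<phi> n) (\<psi> n)) \<longlonglongrightarrow> inner v (to_l2 g)"
    if "form_approx b m \<phi> f" "form_approx b m \<psi> g" for \<phi> \<psi>
  proof -
    have "energy b (\<phi> n) (\<psi> n) = heat.form (to_l2 (\<phi> n)) (to_l2 (\<psi> n))" for n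
      using that by (simp add: form_approx_iff form_eq_energy to_l2_finsupp of_to_l2 finsupp_in_ell2)
    then show ?thesis
      using that heat.form_tendsto[of "\<lambda>n. to_l2 (\<phi> n)" "to_l2 f" v "\<lambda>n. to_l2 (\<psi> n)" "to_l2 g"] f(1)
      by (simp add: form_approx_iff heat.extension_def)
  qed
  obtain \<phi> \<psi> where "form_approx b m \<phi> f" "form_approx b m \<psi> g"
    using f(2) g by (auto simp: closed_form_domain_def)
  then show ?thesis
    unfolding closed_form_def using lim LIMSEQ_unique by (intro the_equality) blast+
qed

lemma closed_form_commute: "closed_form b m f g = closed_form b m g f"
proof -
  define Q where "Q f g c \<longleftrightarrow> (\<forall>\<phi> \<psi>. form_approx b m \<phi> f \<longrightarrow> form_approx b m \<psi> g \<longrightarrow>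
    (\<lambda>n. energy b (\<phi> n) (\<psi> n)) \<longlonglongrightarrow> c)" for f g c
  have "Q g f c" if Q: "Q f g c" for f g c
    unfolding Q_def
  proof (intro allI impI)
    fix \<phi> \<psi> assume "form_approx b m \<phi> g" "form_approx b m \<psi> f"
    then have "(\<lambda>n. energy b (\<psi> n) (\<phi> n)) \<longlonglongrightarrow> c" using Q by (simp add: Q_def)
    then show "(\<lambda>n. energy b (\<phi> n) (\<psi> n)) \<longlonglongrightarrow> c" by (simp only: energy_commute)
  qed
  then have "Q f g = Q g f" by blast
  then show ?thesis by (simp add: closed_form_def Q_def[abs_def] fun_eq_iff)
qed

text \<open>Constant sequences show that \<open>C\<^sub>c(X)\<close> lies in the form domain, so an element of the Laplacian
  satisfies the weak equation against \<open>C\<^sub>c(X)\<close>; the converse is \<open>closed_form_eq\<close>.\<close>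

lemma laplacian_iff:
  "(f, h) \<in> laplacian b m \<longleftrightarrow>
     f \<in> ell2 m \<and> h \<in> ell2 m \<and> (to_l2 f, to_l2 h) \<in> heat.extension"
proof (intro iffI)
  assume "(f, h) \<in> laplacian b m"
  then have f: "f \<in> closed_form_domain b m" and h: "h \<in> ell2 m"
    and eq: "\<And>g. g \<in> closed_form_domain b m \<Longrightarrow> closed_form b m f g = ell2_inner m h g"
    by (auto simp: laplacian_def)
  have "inner (to_l2 f) (lap \<psi>) = inner (to_l2 h) \<psi>" if \<psi>: "\<psi> \<in> finsupp_l2" for \<psi>
  proof -
    have dom: "of_l2 \<psi> \<in> closed_form_domain b m"
      using heat.approximates_const[OF \<psi>] by (auto simp: form_domain_iff of_l2_in_ell2 to_of_l2)
    have "inner (to_l2 f) (lap \<psi>) = closed_form b m (of_l2 \<psi>) f"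
      using closed_form_eq[of "of_l2 \<psi>" "lap \<psi>" f] heat.extension_C[OF \<psi>] dom f
      by (simp add: to_of_l2 inner_commute)
    also have "\<dots> = ell2_inner m h (of_l2 \<psi>)" using eq[OF dom] closed_form_commute by simp
    finally show ?thesis by (simp add: inner_eq_ell2_inner of_to_l2 h)
  qed
  then show "f \<in> ell2 m \<and> h \<in> ell2 m \<and> (to_l2 f, to_l2 h) \<in> heat.extension"
    using f h by (simp add: heat.extension_def form_domain_iff)
next
  assume *: "f \<in> ell2 m \<and> h \<in> ell2 m \<and> (to_l2 f, to_l2 h) \<in> heat.extension"
  then have f: "f \<in> closed_form_domain b m" by (simp add: form_domain_iff heat.extension_def)
  have "closed_form b m f g = ell2_inner m h g" if g: "g \<in> closed_form_domain b m" for g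
    using closed_form_eq[OF _ f g, of "to_l2 h"] * g
    by (simp add: inner_eq_ell2_inner of_to_l2 form_domain_iff)
  then show "(f, h) \<in> laplacian b m" using * f by (simp add: laplacian_def)
qed

definition "conjugate S t v = to_l2 (S t (of_l2 v))"

lemma bounded_operator_iff:
  "bounded_operator m A \<longleftrightarrow>
     (\<forall>f\<in>ell2 m. A f \<in> ell2 m) \<and> bounded_linear (\<lambda>v. to_l2 (A (of_l2 v)))"
proof (cases "\<forall>f\<in>ell2 m. A f \<in> ell2 m")
  case True
  let ?A = "\<lambda>v. to_l2 (A (of_l2 v))"
  have undo: "of_l2 (?A v) = A (of_l2 v)" for v
    by (simp add: True of_to_l2 of_l2_in_ell2)
  have ball: "(\<forall>f\<in>ell2 m. P f) \<longleftrightarrow> (\<forall>v. P (of_l2 v))" for P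
    using of_l2_in_ell2 of_to_l2 by metis
  show ?thesis
  proof
    assume A: "bounded_operator m A"
    then obtain K where K: "\<And>f. f \<in> ell2 m \<Longrightarrow> ell2_norm m (A f) \<le> K * ell2_norm m f"
      unfolding bounded_operator_def by blast
    have "bounded_linear ?A"
    proof (rule bounded_linear_intro[where K = K])
      fix v w :: "'v l2" and c
      have "of_l2 (?A (v + w)) = A (of_l2 (v + w))" by (rule undo)
      also have "\<dots> = (\<lambda>x. A (of_l2 v) x + A (of_l2 w) x)"
        using A of_l2_in_ell2 unfolding of_l2_fun bounded_operator_def by blast
      also have "\<dots> = of_l2 (?A v + ?A w)"
        by (simp only: undo of_l2_fun(1)[of "?A v" "?A w"])
      finally show "?A (v + w) = ?A v + ?A w" by (simp only: of_l2_eq_iff)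
      have "of_l2 (?A (c *\<^sub>R v)) = A (of_l2 (c *\<^sub>R v))" by (rule undo)
      also have "\<dots> = (\<lambda>x. c * A (of_l2 v) x)"
        using A of_l2_in_ell2 unfolding of_l2_fun bounded_operator_def by blast
      also have "\<dots> = of_l2 (c *\<^sub>R ?A v)"
        by (simp only: undo of_l2_fun(2)[of c "?A v"])
      finally show "?A (c *\<^sub>R v) = c *\<^sub>R ?A v" by (simp only: of_l2_eq_iff)
      show "norm (?A v) \<le> norm v * K"
        using K[OF of_l2_in_ell2] unfolding norm_eq_ell2_norm undo by (simp add: mult.commute)
    qed
    with True show "(\<forall>f\<in>ell2 m. A f \<in> ell2 m) \<and> bounded_linear ?A" by blast
  next
    assume "(\<forall>f\<in>ell2 m. A f \<in> ell2 m) \<and> bounded_linear ?A"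
    then interpret bounded_linear ?A by blast
    have "\<exists>C. \<forall>v. norm (?A v) \<le> C * norm v"
      using bounded by (simp add: mult.commute)
    then have "\<exists>C. \<forall>f\<in>ell2 m. ell2_norm m (A f) \<le> C * ell2_norm m f"
      unfolding ball norm_eq_ell2_norm undo .
    moreover have "A (\<lambda>x. of_l2 v x + of_l2 w x) = (\<lambda>x. A (of_l2 v) x + A (of_l2 w) x)" for v w
      using arg_cong[OF add[of v w], of of_l2]
      by (simp only: undo of_l2_fun(1)[of "?A v" "?A w"] of_l2_fun(1)[of v w, symmetric])
    moreover have "A (\<lambda>x. c * of_l2 v x) = (\<lambda>x. c * A (of_l2 v) x)" for c v
      using arg_cong[OF scale[of c v], of of_l2]
      by (simp only: undo of_l2_fun(2)[of c "?A v"] of_l2_fun(2)[of c v, symmetric])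
    ultimately show "bounded_operator m A"
      unfolding bounded_operator_def ball using of_l2_in_ell2 True by blast
  qed
qed (auto simp: bounded_operator_def)

lemma C0_semigroup_iff:
  "C0_semigroup m S \<longleftrightarrow>
     (\<forall>t\<ge>0. \<forall>f\<in>ell2 m. S t f \<in> ell2 m) \<and> strongly_continuous_semigroup (conjugate S)"
proof (cases "\<forall>t\<ge>0. \<forall>f\<in>ell2 m. S t f \<in> ell2 m")
  case True
  have ball: "(\<forall>f\<in>ell2 m. P f) \<longleftrightarrow> (\<forall>v. P (of_l2 v))" for P
    using of_l2_in_ell2 of_to_l2 by metis
  have undo: "of_l2 (conjugate S t v) = S t (of_l2 v)" if "0 \<le> t" for t v
    using that by (simp add: conjugate_def True of_to_l2 of_l2_in_ell2)
  have "(\<forall>t\<ge>0. bounded_operator m (S t)) \<longleftrightarrow> (\<forall>t\<ge>0. bounded_linear (conjugate S t))"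
    using True by (simp add: bounded_operator_iff conjugate_def[abs_def])
  moreover have "(\<forall>f\<in>ell2 m. S 0 f = f) \<longleftrightarrow> (\<forall>v. conjugate S 0 v = v)"
    unfolding ball of_l2_eq_iff[symmetric] by (simp add: undo)
  moreover have "(\<forall>s\<ge>0. \<forall>t\<ge>0. \<forall>f\<in>ell2 m. S (s + t) f = S s (S t f)) \<longleftrightarrow>
      (\<forall>s\<ge>0. \<forall>t\<ge>0. \<forall>v. conjugate S (s + t) v = conjugate S s (conjugate S t v))"
    unfolding ball of_l2_eq_iff[symmetric] by (simp add: undo)
  moreover have "((\<lambda>s. ell2_norm m (\<lambda>x. S s (of_l2 v) x - S t (of_l2 v) x)) \<longlongrightarrow> 0) (at t within {0..})
      \<longleftrightarrow> ((\<lambda>s. conjugate S s v) \<longlongrightarrow> conjugate S t v) (at t within {0..})" if "0 \<le> t" for t v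
  proof -
    have "\<forall>\<^sub>F s in at t within {0..}. ell2_norm m (\<lambda>x. S s (of_l2 v) x - S t (of_l2 v) x)
        = norm (conjugate S s v - conjugate S t v)"
      unfolding eventually_at_filter
      by (rule always_eventually) (use that in \<open>simp add: norm_eq_ell2_norm of_l2_fun undo\<close>)
    then show ?thesis
      by (simp add: tendsto_cong tendsto_norm_zero_iff LIM_zero_iff)
  qed
  then have "(\<forall>f\<in>ell2 m. \<forall>t\<ge>0.
        ((\<lambda>s. ell2_norm m (\<lambda>x. S s f x - S t f x)) \<longlongrightarrow> 0) (at t within {0..}))
      \<longleftrightarrow> (\<forall>v. continuous_on {0..} (\<lambda>t. conjugate S t v))"
    unfolding ball continuous_on_def by auto
  ultimately show ?thesis
    using True unfolding C0_semigroup_def strongly_continuous_semigroup_def by blast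
qed (auto simp: C0_semigroup_def bounded_operator_def)

lemma generator_iff:
  assumes "\<forall>t\<ge>0. \<forall>f\<in>ell2 m. S t f \<in> ell2 m"
  shows "(f, h) \<in> generator m S \<longleftrightarrow>
    f \<in> ell2 m \<and> h \<in> ell2 m \<and> (to_l2 f, to_l2 h) \<in> infinitesimal_generator (conjugate S)"
proof (cases "f \<in> ell2 m \<and> h \<in> ell2 m")
  case True
  have "\<forall>\<^sub>F t in at_right 0. ell2_norm m (\<lambda>x. (S t f x - f x) / t - h x)
      = norm ((conjugate S t (to_l2 f) - to_l2 f) /\<^sub>R t - to_l2 h)"
    using eventually_at_right_less[of 0]
  proof eventually_elim
    case (elim t)
    then have "of_l2 (conjugate S t (to_l2 f)) = S t f"
      using True assms by (simp add: conjugate_def of_to_l2)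
    then show ?case using True
      by (simp add: norm_eq_ell2_norm of_l2_fun of_to_l2 divide_inverse mult.commute)
  qed
  then show ?thesis
    using True by (simp add: generator_def infinitesimal_generator_def tendsto_cong
        tendsto_norm_zero_iff LIM_zero_iff)
qed (auto simp: generator_def)

text \<open>The flow generated by the Friedrichs extension is a witness for the choice that defines the heat
  semigroup, and by uniqueness it agrees with the chosen semigroup on the Hilbert space.\<close>

theorem heat_semigroup_eq_flow:
  assumes "0 \<le> t" "f \<in> ell2 m"
  shows "heat_semigroup b m t f = of_l2 (heat.flow t (to_l2 f))"
proof -
  let ?G = "{(f, \<lambda>x. - h x) |f h. (f, h) \<in> laplacian b m}"
  let ?E = "{(v, - w) |v w. (v, w) \<in> heat.extension}"
  have neg: "(\<lambda>x. - h x) \<in> ell2 m \<and> to_l2 (\<lambda>x. - h x) = - to_l2 h" if "h \<in> ell2 m" for h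
    using that in_ell2_eqI[of "- to_l2 h" "\<lambda>x. - h x"] to_l2_eqI[of "- to_l2 h" "\<lambda>x. - h x"]
    by (simp add: of_to_l2)
  have G: "(f, h) \<in> ?G \<longleftrightarrow> f \<in> ell2 m \<and> h \<in> ell2 m \<and> (to_l2 f, to_l2 h) \<in> ?E" for f h
  proof
    assume "(f, h) \<in> ?G"
    then show "f \<in> ell2 m \<and> h \<in> ell2 m \<and> (to_l2 f, to_l2 h) \<in> ?E"
      using neg by (auto simp: laplacian_iff)
  next
    assume *: "f \<in> ell2 m \<and> h \<in> ell2 m \<and> (to_l2 f, to_l2 h) \<in> ?E"
    then have "(f, \<lambda>x. - h x) \<in> laplacian b m"
      using neg by (auto simp: laplacian_iff)
    then show "(f, h) \<in> ?G" by force
  qed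
  define T where "T = (\<lambda>t f. of_l2 (heat.flow t (to_l2 f)))"
  have T: "\<forall>t\<ge>0. \<forall>f\<in>ell2 m. T t f \<in> ell2 m" by (simp add: T_def of_l2_in_ell2)
  have conj: "conjugate T = heat.flow" by (simp add: fun_eq_iff conjugate_def T_def to_of_l2)
  have "generator m T = ?G"
    unfolding set_eq_iff split_paired_All generator_iff[OF T] G conj heat.flow_generator by simp
  moreover have "C0_semigroup m T"
    unfolding C0_semigroup_iff conj using T heat.flow_strongly_continuous by blast
  ultimately have "C0_semigroup m (heat_semigroup b m) \<and> generator m (heat_semigroup b m) = ?G"
    unfolding heat_semigroup_def by (intro someI[of "\<lambda>T. C0_semigroup m T \<and> generator m T = ?G" T]) simp
  then have S: "\<forall>t\<ge>0. \<forall>f\<in>ell2 m. heat_semigroup b m t f \<in> ell2 m"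
    "strongly_continuous_semigroup (conjugate (heat_semigroup b m))"
    and gen: "generator m (heat_semigroup b m) = ?G"
    by (simp_all add: C0_semigroup_iff)
  have "infinitesimal_generator (conjugate (heat_semigroup b m)) = ?E"
  proof -
    have "(v, w) \<in> infinitesimal_generator (conjugate (heat_semigroup b m)) \<longleftrightarrow> (v, w) \<in> ?E" for v w
      using generator_iff[OF S(1), of "of_l2 v" "of_l2 w"] G[of "of_l2 v" "of_l2 w"]
      unfolding gen to_of_l2 by (simp only: of_l2_in_ell2 simp_thms)
    then show ?thesis by (simp only: set_eq_iff split_paired_All simp_thms)
  qed
  then have "conjugate (heat_semigroup b m) t (to_l2 f) = heat.flow t (to_l2 f)"
    by (rule heat.flow_unique[OF S(2) _ assms(1)])
  then show ?thesis
    using S(1) assms unfolding conjugate_def by (metis of_to_l2)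
qed

section \<open>Comparison with supersolutions\<close>

text \<open>Raising the values at the neighbours while keeping the value at \<open>x\<close> lowers the Laplacian at \<open>x\<close>.\<close>

lemma formal_laplacian_mono_at:
  assumes "q x = w x" "\<And>y. q y \<le> w y"
  shows "formal_laplacian b m w x \<le> formal_laplacian b m q x"
  unfolding formal_laplacian_eq_sum
  by (intro mult_left_mono sum_mono)
    (use assms measure_pos[of x] weight_nonneg in \<open>simp_all add: mult_left_mono\<close>)

text \<open>The hypothesis says that \<open>w\<close> is a supersolution of the equation of the Euler step from \<open>v\<close>. With
  \<open>\<psi> = min \<phi> w\<close> and \<open>\<eta> = \<phi> - \<psi> \<ge> 0\<close>, the functional drops from \<open>\<phi>\<close> to \<open>\<psi>\<close> by
  \<open>|\<eta>|\<^sup>2 + h Q(\<eta>) + 2 (\<psi> - v + h \<Delta>\<psi>, \<eta>)\<close>. The last term is nonnegative: where \<open>\<eta> > 0\<close>,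
  \<open>\<psi>\<close> touches \<open>w\<close> from below, so \<open>\<Delta>\<psi> \<ge> \<Delta>w\<close> there.\<close>

lemma euler_functional_cut_le:
  assumes "0 < h" and w: "\<And>x. 0 \<le> w x"
    and super: "\<And>x. of_l2 v x \<le> w x + h * formal_laplacian b m w x"
    and \<phi>: "\<phi> \<in> finsupp_l2"
  shows "\<exists>\<psi>\<in>finsupp_l2. (\<forall>x. of_l2 \<psi> x \<le> w x) \<and>
    heat.euler_functional h v \<psi> \<le> heat.euler_functional h v \<phi>"
proof -
  define q where "q = (\<lambda>x. min (of_l2 \<phi> x) (w x))"
  define \<psi> where "\<psi> = to_l2 q"
  define \<eta> where "\<eta> = \<phi> - \<psi>"
  have "q \<in> finsupp_fun"
  proof -
    have "{x. q x \<noteq> 0} \<subseteq> {x. of_l2 \<phi> x \<noteq> 0}"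
      using w by (auto simp: q_def min_def)
    then show ?thesis using \<phi> by (auto simp: finsupp_l2_iff finsupp_fun_def intro: finite_subset)
  qed
  then have \<psi>: "\<psi> \<in> finsupp_l2" and q: "of_l2 \<psi> = q"
    by (simp_all add: \<psi>_def to_l2_finsupp of_to_l2 finsupp_in_ell2)
  have \<eta>: "\<eta> \<in> finsupp_l2" and \<phi>_eq: "\<phi> = \<psi> + 1 *\<^sub>R \<eta>"
    using heat.C_diff[OF \<phi> \<psi>] by (simp_all add: \<eta>_def)
  have "0 \<le> inner (\<psi> - v + h *\<^sub>R lap \<psi>) \<eta>"
    unfolding inner_l2_def
  proof (rule infsum_nonneg)
    fix x
    have "coord (\<psi> - v + h *\<^sub>R lap \<psi>) x * coord \<eta> x
        = (q x - of_l2 v x + h * formal_laplacian b m q x) * (of_l2 \<phi> x - q x) * m x"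
      unfolding coord_eq_of_l2 by (simp add: of_l2_lap[OF \<psi>] q \<eta>_def mult_ac)
    moreover have "0 \<le> (q x - of_l2 v x + h * formal_laplacian b m q x) * (of_l2 \<phi> x - q x)"
    proof (cases "of_l2 \<phi> x \<le> w x")
      case False
      then have "q x = w x" by (simp add: q_def)
      then have "formal_laplacian b m w x \<le> formal_laplacian b m q x"
        by (rule formal_laplacian_mono_at) (simp add: q_def)
      then have "h * formal_laplacian b m w x \<le> h * formal_laplacian b m q x"
        using \<open>0 < h\<close> by simp
      then show ?thesis
        using super[of x] False \<open>q x = w x\<close> by (intro mult_nonneg_nonneg) simp_all
    qed (simp add: q_def)
    ultimately show "0 \<le> coord (\<psi> - v + h *\<^sub>R lap \<psi>) x * coord \<eta> x"
      using measure_pos[of x] by simp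
  qed
  then have cross: "0 \<le> inner (\<psi> - v) \<eta> + h * heat.form \<psi> \<eta>"
    by (simp add: heat.form_def inner_add_left)
  have "(norm (\<phi> - v))\<^sup>2 = (norm (\<psi> - v))\<^sup>2 + 2 * inner (\<psi> - v) \<eta> + (norm \<eta>)\<^sup>2"
    unfolding \<phi>_eq power2_norm_eq_inner
    by (simp add: inner_add_left inner_add_right inner_diff_left inner_diff_right inner_commute
        algebra_simps)
  moreover have "heat.form \<phi> \<phi> = heat.form \<psi> \<psi> + 2 * heat.form \<psi> \<eta> + heat.form \<eta> \<eta>"
    unfolding \<phi>_eq heat.form_square_add[OF \<psi> \<eta>] by simp
  ultimately have "heat.euler_functional h v \<phi> - heat.euler_functional h v \<psi>
      = ((norm \<eta>)\<^sup>2 + h * heat.form \<eta> \<eta>) + 2 * (inner (\<psi> - v) \<eta> + h * heat.form \<psi> \<eta>)"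
    by (simp add: heat.euler_functional_def algebra_simps)
  also have "0 \<le> \<dots>"
    using \<open>0 < h\<close> heat.form_nonneg[OF \<eta>] cross
    by (intro add_nonneg_nonneg[OF add_nonneg_nonneg] mult_nonneg_nonneg) simp_all
  finally have "heat.euler_functional h v \<psi> \<le> heat.euler_functional h v \<phi>" by simp
  then show ?thesis using \<psi> q by (intro bexI[of _ \<psi>]) (simp_all add: q_def)
qed

lemma closed_of_l2_le: "closed {u. \<forall>x. of_l2 u x \<le> w x}"
proof -
  have "{u. \<forall>x. of_l2 u x \<le> w x} = (\<Inter>x. {u. coord u x \<le> w x * sqrt (m x)})"
    using sqrt_measure_pos by (auto simp: of_l2_def pos_divide_le_eq)
  moreover have "closed {u. coord u x \<le> w x * sqrt (m x)}" for x
    by (intro closed_Collect_le continuous_on_const linear_continuous_on bounded_linear_coord)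
  ultimately show ?thesis by auto
qed

lemma step_le_supersolution:
  assumes "0 < h" "\<And>x. 0 \<le> w x" "\<And>x. of_l2 v x \<le> w x + h * formal_laplacian b m w x"
  shows "of_l2 (heat.step h v) x \<le> w x"
proof -
  have "heat.step h v \<in> {u. \<forall>x. of_l2 u x \<le> w x}"
    by (rule heat.step_mem_closed[OF assms(1) closed_of_l2_le])
      (use euler_functional_cut_le[OF assms] in auto)
  then show ?thesis by simp
qed

text \<open>After \<open>n\<close> steps compare with \<open>w + nhK\<close>: the Laplacian ignores the constant, and the gain \<open>hK\<close> per
  step pays for \<open>\<Delta>w \<ge> -K\<close>.\<close>

lemma steps_le_supersolution:
  assumes "0 < h" "0 \<le> K" "\<And>x. 0 \<le> w x" "\<And>x. - K \<le> formal_laplacian b m w x"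
    and "\<And>x. of_l2 v x \<le> w x"
  shows "of_l2 ((heat.step h ^^ n) v) x \<le> w x + K * (real n * h)"
proof (induction n arbitrary: x)
  case (Suc n)
  have "of_l2 (heat.step h ((heat.step h ^^ n) v)) x \<le> w x + K * (real (Suc n) * h)"
  proof (rule step_le_supersolution[OF assms(1)])
    fix x
    show "0 \<le> w x + K * (real (Suc n) * h)" using assms by simp
    have "of_l2 ((heat.step h ^^ n) v) x \<le> w x + K * (real n * h)" by (rule Suc)
    also have "\<dots> = w x + K * (real (Suc n) * h) + h * (- K)" by (simp add: algebra_simps)
    also have "\<dots> \<le> w x + K * (real (Suc n) * h)
        + h * formal_laplacian b m (\<lambda>x. w x + K * (real (Suc n) * h)) x"
      unfolding formal_laplacian_add_const using assms(1) assms(4)[of x]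
      by (intro add_left_mono mult_left_mono) simp_all
    finally show "of_l2 ((heat.step h ^^ n) v) x \<le> w x + K * (real (Suc n) * h)
        + h * formal_laplacian b m (\<lambda>x. w x + K * (real (Suc n) * h)) x" .
  qed
  then show ?case by simp
qed (simp add: assms)

theorem flow_le_supersolution:
  assumes "0 \<le> t" "0 \<le> K" "\<And>x. 0 \<le> w x" "\<And>x. - K \<le> formal_laplacian b m w x"
    and "\<And>x. of_l2 v x \<le> w x"
  shows "of_l2 (heat.flow t v) x \<le> w x + K * t"
proof (rule LIMSEQ_le)
  show "(\<lambda>j. of_l2 (heat.euler j t v) x) \<longlonglongrightarrow> of_l2 (heat.flow t v) x"
    unfolding of_l2_def
    by (intro tendsto_intros bounded_linear.tendsto[OF bounded_linear_coord] heat.euler_tendsto assms)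
      simp
  show "(\<lambda>j. w x + K * (real (nat \<lfloor>2 ^ j * t\<rfloor>) * (1 / 2 ^ j))) \<longlonglongrightarrow> w x + K * t"
    by (intro tendsto_intros heat.floor_time_tendsto assms)
  show "\<exists>N. \<forall>j\<ge>N. of_l2 (heat.euler j t v) x \<le> w x + K * (real (nat \<lfloor>2 ^ j * t\<rfloor>) * (1 / 2 ^ j))"
    unfolding heat.euler_def
    by (intro exI allI impI steps_le_supersolution assms) simp
qed

lemma formal_laplacian_const: "formal_laplacian b m (\<lambda>_. c) x = 0"
  by (simp add: formal_laplacian_eq_sum)

lemma flow_nonneg:
  assumes "0 \<le> t" "\<And>x. 0 \<le> of_l2 v x" shows "0 \<le> of_l2 (heat.flow t v) x"
  using flow_le_supersolution[of t 0 "\<lambda>_. 0" "- v" x] assms heat.flow_scale[OF assms(1), of "-1" v]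
  by (simp add: formal_laplacian_const)

lemma flow_le_1:
  assumes "0 \<le> t" "\<And>x. of_l2 v x \<le> 1" shows "of_l2 (heat.flow t v) x \<le> 1"
  using flow_le_supersolution[of t 0 "\<lambda>_. 1" v x] assms by (simp add: formal_laplacian_const)

lemma indicator_finsupp: "finite F \<Longrightarrow> (indicator F :: _ \<Rightarrow> real) \<in> finsupp_fun"
  by (simp add: finsupp_fun_def indicator_def)

lemma of_l2_indicator: "finite F \<Longrightarrow> of_l2 (to_l2 (indicator F)) = indicator F"
  by (simp add: of_to_l2 finsupp_in_ell2 indicator_finsupp)

section \<open>Transition probabilities\<close>

text \<open>The heat kernel times the measure of the target, i.e. the probability to move from \<open>x\<close> to \<open>y\<close> in
  time \<open>t\<close>.\<close>

definition "transition t x y = of_l2 (heat.flow t (to_l2 (indicator {y}))) x"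

lemma heat_kernel_eq: "0 \<le> t \<Longrightarrow> heat_kernel b m t x y * m y = transition t x y"
  by (simp add: heat_kernel_def heat_semigroup_eq_flow transition_def finsupp_in_ell2
      indicator_finsupp)

lemma transition_nonneg: "0 \<le> t \<Longrightarrow> 0 \<le> transition t x y"
  unfolding transition_def by (rule flow_nonneg) (simp_all add: of_l2_indicator)

lemma sum_transition_le_1:
  assumes "0 \<le> t" "finite F" shows "(\<Sum>y\<in>F. transition t x y) \<le> 1"
proof -
  interpret flow: bounded_linear "heat.flow t" by (rule heat.flow_bounded_linear) fact
  have of_sum: "of_l2 (\<Sum>y\<in>F. u y) x = (\<Sum>y\<in>F. of_l2 (u y) x)" for u x
    by (induction F rule: infinite_finite_induct) simp_all
  have "of_l2 (\<Sum>y\<in>F. to_l2 (indicator {y})) x \<le> 1" for x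
    using assms(2) card_mono[of "{x}" "F \<inter> {x}"] by (simp add: of_sum of_l2_indicator indicator_def)
  from flow_le_1[OF assms(1) this, of x] show ?thesis
    by (simp add: transition_def flow.sum of_sum)
qed

lemma transition_summable: "0 \<le> t \<Longrightarrow> (\<lambda>y. transition t x y) summable_on UNIV"
  by (rule nonneg_bdd_above_summable_on)
    (auto intro!: transition_nonneg sum_transition_le_1 bdd_aboveI2[where M = 1])

lemma infsum_transition_le_1: "0 \<le> t \<Longrightarrow> (\<Sum>\<^sub>\<infinity>y. transition t x y) \<le> 1"
  by (rule infsum_le_finite_sums[OF transition_summable sum_transition_le_1])

lemma heat_operator_eq:
  "0 \<le> t \<Longrightarrow> heat_operator b m t f x = (\<Sum>\<^sub>\<infinity>y. transition t x y * f y)"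
proof -
  assume "0 \<le> t"
  have "heat_kernel b m t x y * f y * m y = transition t x y * f y" for y
    unfolding heat_kernel_eq[OF \<open>0 \<le> t\<close>, symmetric] by (simp add: mult_ac)
  then show ?thesis by (simp only: heat_operator_def)
qed

text \<open>Approximate \<open>f\<close> within \<open>e/2\<close> by a finitely supported \<open>g\<close>. As the transition probabilities from \<open>x\<close>
  have total mass at most one, \<open>P\<^sub>t f\<close> stays within \<open>e/2\<close> of \<open>P\<^sub>t g\<close>, a finite combination of
  functions that vanish at infinity.\<close>

theorem feller_if_transition_vanishes:
  assumes vanish: "\<And>t y e. 0 \<le> t \<Longrightarrow> 0 < e \<Longrightarrow> finite {x. e \<le> transition t x y}"
  shows "feller b m"
  unfolding feller_def
proof (intro allI impI ballI)
  fix t :: real and f :: "'v \<Rightarrow> real"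
  assume t: "0 \<le> t" and f: "f \<in> C0_fun"
  show "heat_operator b m t f \<in> C0_fun"
    unfolding C0_fun_def mem_Collect_eq
  proof (intro allI impI)
    fix e :: real assume "0 < e"
    then have "0 < e / 2" by simp
    then obtain g where g: "g \<in> finsupp_fun" "\<And>x. \<bar>f x - g x\<bar> \<le> e / 2"
      using f unfolding C0_fun_def mem_Collect_eq by blast
    define S where "S = {y. g y \<noteq> 0}"
    define M where "M = (\<Sum>y\<in>S. \<bar>g y\<bar>)"
    have S: "finite S" using g(1) by (simp add: S_def finsupp_fun_def)
    have "0 \<le> M" by (simp add: M_def sum_nonneg)
    define d where "d = e / 2 / (M + 1)"
    have "0 < d" using \<open>0 < e\<close> \<open>0 \<le> M\<close> by (simp add: d_def)
    define F where "F = (\<Union>y\<in>S. {x. d \<le> transition t x y})"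
    have "finite F" using S vanish[OF t \<open>0 < d\<close>] by (simp add: F_def)
    have approx: "\<bar>heat_operator b m t f x - (\<Sum>y\<in>S. transition t x y * g y)\<bar> \<le> e / 2" for x
    proof -
      have "(\<lambda>y. transition t x y * (e / 2)) summable_on UNIV"
        by (intro summable_on_cmult_left transition_summable t)
      moreover have bound: "\<bar>transition t x y * (f y - g y)\<bar> \<le> transition t x y * (e / 2)" for y
        using mult_left_mono[OF g(2)[of y] transition_nonneg[OF t, of x y]]
          transition_nonneg[OF t, of x y] by (simp add: abs_mult)
      ultimately have abs: "(\<lambda>y. \<bar>transition t x y * (f y - g y)\<bar>) summable_on UNIV"
        by (rule summable_on_comparison_test) simp
      then have diff: "(\<lambda>y. transition t x y * (f y - g y)) summable_on UNIV"
        using summable_on_iff_abs_summable_on_real[of "\<lambda>y. transition t x y * (f y - g y)"] by simp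
      have fin: "(\<lambda>y. transition t x y * g y) summable_on UNIV"
        "(\<Sum>\<^sub>\<infinity>y. transition t x y * g y) = (\<Sum>y\<in>S. transition t x y * g y)"
      proof -
        have "((\<lambda>y. transition t x y * g y) has_sum (\<Sum>y\<in>S. transition t x y * g y)) S"
          using S by simp
        then have "((\<lambda>y. transition t x y * g y) has_sum (\<Sum>y\<in>S. transition t x y * g y)) UNIV"
          by (rule has_sum_cong_neutral[THEN iffD1, rotated -1]) (auto simp: S_def)
        then show "(\<lambda>y. transition t x y * g y) summable_on UNIV"
          "(\<Sum>\<^sub>\<infinity>y. transition t x y * g y) = (\<Sum>y\<in>S. transition t x y * g y)"
          by (auto simp: has_sum_iff)
      qed
      have "(\<Sum>\<^sub>\<infinity>y. transition t x y * f y)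
          = (\<Sum>\<^sub>\<infinity>y. transition t x y * (f y - g y) + transition t x y * g y)"
        by (simp add: algebra_simps)
      also have "\<dots> = (\<Sum>\<^sub>\<infinity>y. transition t x y * (f y - g y)) + (\<Sum>y\<in>S. transition t x y * g y)"
        by (simp add: infsum_add diff fin)
      finally have "heat_operator b m t f x - (\<Sum>y\<in>S. transition t x y * g y)
          = (\<Sum>\<^sub>\<infinity>y. transition t x y * (f y - g y))"
        by (simp add: heat_operator_eq t)
      also have "\<bar>\<dots>\<bar> \<le> (\<Sum>\<^sub>\<infinity>y. \<bar>transition t x y * (f y - g y)\<bar>)"
        using norm_infsum_bound[of "\<lambda>y. transition t x y * (f y - g y)" UNIV] abs by simp
      also have "\<dots> \<le> (\<Sum>\<^sub>\<infinity>y. transition t x y * (e / 2))"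
        by (intro infsum_mono abs bound summable_on_cmult_left transition_summable t)
      also have "\<dots> = (\<Sum>\<^sub>\<infinity>y. transition t x y) * (e / 2)" by (rule infsum_cmult_left')
      also have "\<dots> \<le> 1 * (e / 2)"
        using \<open>0 < e\<close> by (intro mult_right_mono infsum_transition_le_1 t) simp
      finally show ?thesis by simp
    qed
    have small: "\<bar>\<Sum>y\<in>S. transition t x y * g y\<bar> \<le> e / 2" if "x \<notin> F" for x
    proof -
      have "\<bar>\<Sum>y\<in>S. transition t x y * g y\<bar> \<le> (\<Sum>y\<in>S. d * \<bar>g y\<bar>)"
      proof (rule order_trans[OF sum_abs sum_mono])
        fix y assume "y \<in> S"
        then have "transition t x y \<le> d" using that by (force simp: F_def)
        then show "\<bar>transition t x y * g y\<bar> \<le> d * \<bar>g y\<bar>"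
          using transition_nonneg[OF t, of x y] by (simp add: abs_mult mult_right_mono)
      qed
      also have "\<dots> = d * M" by (simp add: M_def sum_distrib_left)
      also have "\<dots> \<le> d * (M + 1)" using \<open>0 < d\<close> by simp
      also have "\<dots> = e / 2"
        unfolding d_def using \<open>0 \<le> M\<close> by (simp del: divide_divide_eq_left)
      finally show ?thesis .
    qed
    show "\<exists>k\<in>finsupp_fun. \<forall>x. \<bar>heat_operator b m t f x - k x\<bar> \<le> e"
    proof (intro bexI[of _ "\<lambda>x. if x \<in> F then heat_operator b m t f x else 0"] allI)
      show "(\<lambda>x. if x \<in> F then heat_operator b m t f x else 0) \<in> finsupp_fun"
        using \<open>finite F\<close> by (auto simp: finsupp_fun_def intro: finite_subset)
      fix x
      show "\<bar>heat_operator b m t f x - (if x \<in> F then heat_operator b m t f x else 0)\<bar> \<le> e"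
        using approx[of x] small[of x] \<open>0 < e\<close> abs_triangle_ineq[of
            "heat_operator b m t f x - (\<Sum>y\<in>S. transition t x y * g y)" "\<Sum>y\<in>S. transition t x y * g y"]
        by (cases "x \<in> F") simp_all
    qed
  qed
qed

section \<open>The graph distance and its Laplacian\<close>

lemma adjacent_commute: "adjacent b x y \<longleftrightarrow> adjacent b y x"
  by (simp add: adjacent_def weight_sym)

lemma adjacent_pow_commute: "(adjacent b ^^ n) x y \<Longrightarrow> (adjacent b ^^ n) y x"
proof (induction n arbitrary: x y)
  case (Suc n)
  then obtain z where "(adjacent b ^^ n) x z" "adjacent b z y" by auto
  then have "adjacent b y z" "(adjacent b ^^ n) z x" using Suc.IH adjacent_commute by blast+
  then show ?case by (rule relpowp_Suc_I2)
qed auto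

lemma graph_dist_commute: "graph_dist b x y = graph_dist b y x"
  using adjacent_pow_commute unfolding graph_dist_def by metis

lemma graph_dist_self: "graph_dist b x x = 0"
  unfolding graph_dist_def by (rule Least_eq_0) simp

lemma graph_dist_adjacent_le:
  assumes "connected_graph b" "0 < b x y"
  shows "graph_dist b x z \<le> Suc (graph_dist b y z)"
proof -
  have "(adjacent b ^^ graph_dist b y z) y z"
    using assms(1) unfolding connected_graph_def graph_dist_def by (metis LeastI_ex)
  moreover have "adjacent b x y" using assms(2) by (simp add: adjacent_def)
  ultimately have "(adjacent b ^^ Suc (graph_dist b y z)) x z" by (rule relpowp_Suc_I2[rotated])
  then show ?thesis unfolding graph_dist_def[of b x z] by (rule Least_le)
qed

lemma finite_ball:
  assumes "connected_graph b" shows "finite {x. graph_dist b x y \<le> n}"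
proof -
  have "{x. graph_dist b x y \<le> n} = (\<Union>k\<le>n. graph_sphere b y (int k))"
    by (auto simp: graph_sphere_def)
  then show ?thesis using finite_sphere[OF assms] by simp
qed

text \<open>Along an edge the distance to \<open>x0\<close> changes by \<open>-1\<close>, \<open>0\<close> or \<open>1\<close>, so only the two
  neighbouring spheres contribute to the Laplacian of the distance.\<close>

lemma formal_laplacian_graph_dist:
  assumes "connected_graph b"
  shows "formal_laplacian b m (\<lambda>x. real (graph_dist b x x0)) x
    = inner_curvature b m x0 x - outer_curvature b m x0 x"
proof -
  let ?\<rho> = "\<lambda>x. graph_dist b x x0"
  let ?S = "\<lambda>r. graph_sphere b x0 r"
  define U where "U = {y. b x y > 0} \<union> ?S (int (?\<rho> x) + 1) \<union> ?S (int (?\<rho> x) - 1)"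
  have U: "finite U" using finite_sphere[OF assms] locally_finite by (simp add: U_def)
  have restrict: "(\<Sum>y\<in>?S r. b x y) = (\<Sum>y\<in>U. if y \<in> ?S r then b x y else 0)" if "?S r \<subseteq> U" for r
    using that U by (simp add: sum.If_cases Int_absorb1)
  have summand: "b x y * (real (?\<rho> x) - real (?\<rho> y))
      = (if y \<in> ?S (int (?\<rho> x) - 1) then b x y else 0) - (if y \<in> ?S (int (?\<rho> x) + 1) then b x y else 0)" for y
  proof (cases "b x y > 0")
    case True
    then have "?\<rho> x \<le> Suc (?\<rho> y)" "?\<rho> y \<le> Suc (?\<rho> x)"
      using graph_dist_adjacent_le[OF assms, of x y x0] graph_dist_adjacent_le[OF assms, of y x x0]
      by (simp_all add: weight_sym[of y x])
    then consider "?\<rho> x = Suc (?\<rho> y)" | "?\<rho> y = ?\<rho> x" | "?\<rho> y = Suc (?\<rho> x)" by linarith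
    then show ?thesis by cases (simp_all add: graph_sphere_def)
  next
    case False
    then show ?thesis using weight_nonneg[of x y] by simp
  qed
  have spheres: "?S (int (?\<rho> x) - 1) \<subseteq> U" "?S (int (?\<rho> x) + 1) \<subseteq> U" by (auto simp: U_def)
  have "(\<Sum>y\<in>U. b x y * (real (?\<rho> x) - real (?\<rho> y)))
      = (\<Sum>y\<in>?S (int (?\<rho> x) - 1). b x y) - (\<Sum>y\<in>?S (int (?\<rho> x) + 1). b x y)"
    by (simp only: summand sum_subtractf restrict[OF spheres(1)] restrict[OF spheres(2)])
  moreover have "(\<Sum>y\<in>{y. b x y > 0}. b x y * (real (?\<rho> x) - real (?\<rho> y)))
      = (\<Sum>y\<in>U. b x y * (real (?\<rho> x) - real (?\<rho> y)))"
  proof (rule sum.mono_neutral_left)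
    show "\<forall>y\<in>U - {y. b x y > 0}. b x y * (real (?\<rho> x) - real (?\<rho> y)) = 0"
      using weight_nonneg[of x] by (auto simp: less_le)
  qed (use U in \<open>auto simp: U_def\<close>)
  ultimately show ?thesis
    by (simp add: formal_laplacian_eq_sum inner_curvature_def outer_curvature_def
        right_diff_distrib diff_divide_distrib)
qed

text \<open>Compare \<open>d(y, x)\<close> times the indicator of \<open>y\<close> with the supersolution \<open>d(-, x)\<close>, and evaluate at the
  base vertex \<open>x\<close>, where the latter vanishes.\<close>

lemma transition_le_distance:
  assumes "connected_graph b" "0 \<le> K" "0 \<le> t"
    and curv: "\<And>z. outer_curvature b m x z - inner_curvature b m x z \<le> K"
  shows "real (graph_dist b y x) * transition t x y \<le> K * t"
proof -
  let ?d = "real (graph_dist b y x)"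
  have "of_l2 (heat.flow t (?d *\<^sub>R to_l2 (indicator {y}))) x \<le> real (graph_dist b x x) + K * t"
  proof (rule flow_le_supersolution[OF assms(3,2), where w = "\<lambda>z. real (graph_dist b z x)"])
    fix z
    show "- K \<le> formal_laplacian b m (\<lambda>z. real (graph_dist b z x)) z"
      using curv[of z] by (simp add: formal_laplacian_graph_dist assms(1))
    show "of_l2 (?d *\<^sub>R to_l2 (indicator {y})) z \<le> real (graph_dist b z x)"
      by (simp add: of_l2_indicator indicator_def)
  qed simp
  then show ?thesis
    by (simp add: heat.flow_scale assms(3) transition_def graph_dist_self)
qed

end

theorem theorem4p2:
  fixes b :: "'v \<Rightarrow> 'v \<Rightarrow> real" and m :: "'v \<Rightarrow> real" and K :: real
  assumes "weighted_graph b m"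
    and "connected_graph b"
    and "K > 0"
    and "\<And>x0 x. outer_curvature b m x0 x - inner_curvature b m x0 x \<le> K"
  shows "feller b m"
proof -
  interpret weighted_graph b m by fact
  show ?thesis
  proof (rule feller_if_transition_vanishes)
    fix t e :: real and y assume t: "0 \<le> t" and "0 < e"
    have "real (graph_dist b x y) \<le> K * t / e" if "e \<le> transition t x y" for x
    proof -
      have "real (graph_dist b x y) * e \<le> real (graph_dist b x y) * transition t x y"
        using that by (simp add: mult_left_mono)
      also have "\<dots> \<le> K * t"
        using transition_le_distance[of K t x y] assms t by (simp add: graph_dist_commute)
      finally show ?thesis using \<open>0 < e\<close> by (simp add: pos_le_divide_eq)
    qed
    then have "{x. e \<le> transition t x y} \<subseteq> {x. graph_dist b x y \<le> nat \<lfloor>K * t / e\<rfloor>}"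
      by (auto simp: le_nat_floor)
    then show "finite {x. e \<le> transition t x y}"
      using finite_ball[OF assms(2)] finite_subset by blast
  qed
qed

end
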